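(* Let $z:\mathbb Z^3\to\mathbb C$ be an isomonodromic solution of the cross-ratio system $( * )$ (see context) with the matrix $\mathcal A_{k,\ell,m}$ of the form $$\mathcal A_{k,\ell,m}(\mu)=\frac{C_{k,\ell,m}}{\mu}+\sum_{n=1}^3\frac{B^{(n)}_{k,\ell,m}}{\mu-\frac1{\Delta_n}}$$ with $\mu$-independent matrices $C_{k,\ell,m},B^{(n)}_{k,\ell,m}$ and normalized trace $\operatorname{tr}\mathcal A_{0,0,0}(\mu)=0$. Then there are constants $b,c,d,a_1,a_2,a_3\in\mathbb C$ such that, writing $z=z_{k,\ell,m}$ and $$f_1=z_{k+1,\ell,m}-z,\ \ f_1^-=z-z_{k-1,\ell,m},\quad f_2=z_{k,\ell+1,m}-z,\ \ f_2^-=z-z_{k,\ell-1,m},\quad f_3=z_{k,\ell,m+1}-z,\ \ f_3^-=z-z_{k,\ell,m-1},$$ $k_1=k$, $k_2=\ell$, $k_3=m$, these matrices have the form $$C_{k,\ell,m}=\frac12\begin{pmatrix}-bz-\frac c2&bz^2+cz+d\\-b&bz+\frac c2\end{pmatrix},\qquad B^{(n)}_{k,\ell,m}=\frac{k_n-a_n}{f_n+f_n^-}\begin{pmatrix}f_n&-f_nf_n^-\\-1&f_n^-\end{pmatrix}+\frac{a_n}2I\quad(n=1,2,3),$$ and $z_{k,\ell,m}$ satisfies the constraint $$bz^2+cz+d=\sum_{n=1}^3 2(k_n-a_n)\frac{f_nf_n^-}{f_n+f_n^-}\qquad\text{for all }(k,\ell,m)\in\mathbb Z^3.\qquad( ** )$$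 Conversely, any solution $z:\mathbb Z^3\to\mathbb C$ of the system $( * )$, $( ** )$ is isomonodromic with $\mathcal A_{k,\ell,m}(\mu)$ given by the formulas above.
   Context: $\Delta_1,\Delta_2,\Delta_3\in\mathbb C\setminus\{0\}$ are pairwise distinct constants. Cross-ratio: $q(z_1,z_2,z_3,z_4)=\dfrac{(z_2-z_1)(z_4-z_3)}{(z_3-z_2)(z_1-z_4)}$. The cross-ratio system $( * )$, for all $(k,\ell,m)\in\mathbb Z^3$: $$q(z_{k,\ell,m},z_{k+1,\ell,m},z_{k+1,\ell,m-1},z_{k,\ell,m-1})=\tfrac{\Delta_1}{\Delta_3},\quad q(z_{k,\ell,m},z_{k,\ell,m+1},z_{k,\ell-1,m+1},z_{k,\ell-1,m})=\tfrac{\Delta_3}{\Delta_2},$$ $$q(z_{k,\ell,m},z_{k,\ell+1,m},z_{k-1,\ell+1,m},z_{k-1,\ell,m})=\tfrac{\Delta_2}{\Delta_1}.$$ To an edge from $p_{out}$ to $p_{in}=p_{out}+e_n$ ($e_1,e_2,e_3$ the standard basis of $\mathbb Z^3$) attach $$\mathcal L^{(n)}(\mu)=\begin{pmatrix}1&z_{in}-z_{out}\\ \mu\frac{\Delta_n}{z_{in}-z_{out}}&1\end{pmatrix}.$$ A solution $z$ of $( * )$ is isomonodromic if there is a wave function $\Phi_{k,\ell,m}(\mu)$, with values in $GL(2,\mathbb C)$ for generic $\mu$ (possibly multivalued in $\mu$), satisfying $\Phi_{p+e_n}(\mu)=\mathcal L^{(n)}(\mu)\Phi_p(\mu)$ for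 all $p\in\mathbb Z^3$, $n=1,2,3$ (with $\mathcal L^{(n)}$ of the edge $(p,p+e_n)$), and a linear differential equation $\frac{d}{d\mu}\Phi_{k,\ell,m}(\mu)=\mathcal A_{k,\ell,m}(\mu)\Phi_{k,\ell,m}(\mu)$, where $\mathcal A_{k,\ell,m}(\mu)$ are $2\times2$ matrices meromorphic in $\mu$ with poles whose positions and orders do not depend on $(k,\ell,m)$. It is assumed throughout that neighboring values of $z$ are distinct and that all denominators $f_n+f_n^-$ (i.e. $z_{p+e_n}-z_{p-e_n}$) are nonzero.
   Formalization: Poles "whose positions and orders do not depend on (k,l,m)" is read as: positions and orders bounded by one divisor independent of (k,l,m). Literally the converse fails: if a_n=0, B^(n) vanishes where k_n=0, e.g. for z=sum alpha_n k_n with alpha_n^2=Delta_n. *)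

theory Defs
  imports "HOL-Complex_Analysis.Complex_Analysis"
begin

text \<open>
  The lattice \<open>\<int>\<^sup>3\<close> is the type \<open>int ^ 3\<close>; its coordinate directions are the elements
  \<open>1, 2, 3\<close> of the index type \<open>3\<close> (in which \<open>3 = 0\<close>).
\<close>

abbreviation step :: "3 \<Rightarrow> int ^ 3" where
  "step n \<equiv> axis n 1"

definition fwd :: "(int ^ 3 \<Rightarrow> complex) \<Rightarrow> 3 \<Rightarrow> int ^ 3 \<Rightarrow> complex" where
  "fwd z n p = z (p + step n) - z p"

definition bwd :: "(int ^ 3 \<Rightarrow> complex) \<Rightarrow> 3 \<Rightarrow> int ^ 3 \<Rightarrow> complex" where
  "bwd z n p = z p - z (p - step n)"

definition nondegenerate :: "(int ^ 3 \<Rightarrow> complex) \<Rightarrow> bool" where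
  "nondegenerate z \<longleftrightarrow>
     (\<forall>p n. z (p + step n) \<noteq> z p) \<and> (\<forall>p n. fwd z n p + bwd z n p \<noteq> 0)"

definition cross_ratio :: "complex \<Rightarrow> complex \<Rightarrow> complex \<Rightarrow> complex \<Rightarrow> complex" where
  "cross_ratio z1 z2 z3 z4 = ((z2 - z1) * (z4 - z3)) / ((z3 - z2) * (z1 - z4))"

definition cross_ratio_system :: "(3 \<Rightarrow> complex) \<Rightarrow> (int ^ 3 \<Rightarrow> complex) \<Rightarrow> bool" where
  "cross_ratio_system \<Delta> z \<longleftrightarrow>
     (\<forall>p. cross_ratio (z p) (z (p + step 1)) (z (p + step 1 - step 3)) (z (p - step 3))
            = \<Delta> 1 / \<Delta> 3 \<and>
          cross_ratio (z p) (z (p + step 3)) (z (p + step 3 - step 2)) (z (p - step 2))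
            = \<Delta> 3 / \<Delta> 2 \<and>
          cross_ratio (z p) (z (p + step 2)) (z (p + step 2 - step 1)) (z (p - step 1))
            = \<Delta> 2 / \<Delta> 1)"

definition mat2 :: "complex \<Rightarrow> complex \<Rightarrow> complex \<Rightarrow> complex \<Rightarrow> complex ^ 2 ^ 2" where
  "mat2 a b c d = vector [vector [a, b], vector [c, d]]"

definition cscale :: "complex \<Rightarrow> complex ^ 2 ^ 2 \<Rightarrow> complex ^ 2 ^ 2"  (infixr \<open>\<cdot>\<close> 75) where
  "c \<cdot> M = (\<chi> i j. c * M $ i $ j)"

definition lax :: "(3 \<Rightarrow> complex) \<Rightarrow> (int ^ 3 \<Rightarrow> complex) \<Rightarrow> 3 \<Rightarrow> int ^ 3 \<Rightarrow> complex \<Rightarrow> complex ^ 2 ^ 2" where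
  "lax \<Delta> z n p \<mu> = mat2 1 (fwd z n p) (\<mu> * (\<Delta> n / fwd z n p)) 1"

text \<open>
  A single-valued branch, over a set \<open>D\<close> of spectral parameters, of a wave function that solves
  \<open>d\<Phi>/d\<mu> = A \<Phi>\<close>.
\<close>

definition wave_branch ::
  "(3 \<Rightarrow> complex) \<Rightarrow> (int ^ 3 \<Rightarrow> complex) \<Rightarrow> (int ^ 3 \<Rightarrow> complex \<Rightarrow> complex ^ 2 ^ 2) \<Rightarrow>
   complex set \<Rightarrow> (int ^ 3 \<Rightarrow> complex \<Rightarrow> complex ^ 2 ^ 2) \<Rightarrow> bool" where
  "wave_branch \<Delta> z A D \<Phi> \<longleftrightarrow>
     (\<forall>p. \<forall>\<mu>\<in>D.
        invertible (\<Phi> p \<mu>) \<and>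
        (\<forall>n. \<Phi> (p + step n) \<mu> = lax \<Delta> z n p \<mu> ** \<Phi> p \<mu>) \<and>
        (\<forall>i j. ((\<lambda>\<nu>. \<Phi> p \<nu> $ i $ j) has_field_derivative (A p \<mu> ** \<Phi> p \<mu>) $ i $ j) (at \<mu>)))"

text \<open>
  A possibly multivalued wave function on the complement of the exceptional set \<open>S\<close> is given
  by its branches: \<open>W D\<close> is the set of branches over a simply connected domain \<open>D\<close>, and a branch
  over \<open>D\<close> continues analytically to a branch over any \<open>D'\<close> that meets \<open>D\<close> in a connected
  set. Chains of discs then give the continuation along arbitrary paths that avoid \<open>S\<close>.
\<close>

definition multivalued_wave_function ::
  "(3 \<Rightarrow> complex) \<Rightarrow> (int ^ 3 \<Rightarrow> complex) \<Rightarrow> (int ^ 3 \<Rightarrow> complex \<Rightarrow> complex ^ 2 ^ 2) \<Rightarrow>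
   complex set \<Rightarrow> (complex set \<Rightarrow> (int ^ 3 \<Rightarrow> complex \<Rightarrow> complex ^ 2 ^ 2) set) \<Rightarrow> bool" where
  "multivalued_wave_function \<Delta> z A S W \<longleftrightarrow>
     (\<forall>D. open D \<and> simply_connected D \<and> D \<subseteq> - S \<longrightarrow>
        W D \<noteq> {} \<and> (\<forall>\<Phi>\<in>W D. wave_branch \<Delta> z A D \<Phi>)) \<and>
     (\<forall>D D'. open D \<and> simply_connected D \<and> D \<subseteq> - S \<and>
             open D' \<and> simply_connected D' \<and> D' \<subseteq> - S \<and> connected (D \<inter> D') \<longrightarrow>
        (\<forall>\<Phi>\<in>W D. \<exists>\<Phi>'\<in>W D'. \<forall>p. \<forall>\<mu>\<in>D \<inter> D'. \<Phi>' p \<mu> = \<Phi> p \<mu>))"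

text \<open>
  The poles of all \<open>A p\<close> are bounded by one divisor \<open>N\<close> that does not depend on the lattice point,
  with discrete support. Equality of the actual pole divisors would be too strict: the residue
  \<open>B\<^bsup>(n)\<^esup>\<close> of the theorem vanishes where \<open>k\<^sub>n = 0\<close> when \<open>a\<^sub>n = 0\<close>, for instance for the linear
  solutions \<open>z = \<alpha>\<^sub>1 k\<^sub>1 + \<alpha>\<^sub>2 k\<^sub>2 + \<alpha>\<^sub>3 k\<^sub>3\<close> with \<open>\<alpha>\<^sub>n\<^sup>2 = \<Delta>\<^sub>n\<close>.
  The exceptional set \<open>S\<close> contains, besides the poles, the non-generic \<open>\<mu>\<close> at which \<open>\<Phi>\<close> may
  fail to be invertible, such as \<open>1/\<Delta>\<^sub>n\<close>, where \<open>det (lax \<Delta> z n p \<mu>) = 1 - \<mu> \<Delta>\<^sub>n\<close> vanishes.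
\<close>

definition isomonodromic_with ::
  "(3 \<Rightarrow> complex) \<Rightarrow> (int ^ 3 \<Rightarrow> complex) \<Rightarrow> (int ^ 3 \<Rightarrow> complex \<Rightarrow> complex ^ 2 ^ 2) \<Rightarrow> bool" where
  "isomonodromic_with \<Delta> z A \<longleftrightarrow>
     cross_ratio_system \<Delta> z \<and>
     (\<exists>(N :: complex \<Rightarrow> nat) S W.
        (\<forall>x. \<not> x islimpt S) \<and>
        {x. N x \<noteq> 0} \<subseteq> S \<and>
        (\<forall>p i j. (\<lambda>\<mu>. A p \<mu> $ i $ j) meromorphic_on UNIV \<and>
                 (\<lambda>\<mu>. A p \<mu> $ i $ j) holomorphic_on - S \<and>
                 (\<forall>x. is_pole (\<lambda>\<mu>. A p \<mu> $ i $ j) x \<longrightarrow>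
                        - zorder (\<lambda>\<mu>. A p \<mu> $ i $ j) x \<le> int (N x))) \<and>
        multivalued_wave_function \<Delta> z A S W)"

text \<open>
  At \<open>\<mu> = 0\<close> and \<open>\<mu> = 1/\<Delta>\<^sub>n\<close> this takes a meaningless value, since \<open>1 / 0 = 0\<close>; the predicate
  \<open>isomonodromic_with\<close> is insensitive to the values there.
\<close>

definition fuchsian ::
  "(3 \<Rightarrow> complex) \<Rightarrow> (int ^ 3 \<Rightarrow> complex ^ 2 ^ 2) \<Rightarrow> (3 \<Rightarrow> int ^ 3 \<Rightarrow> complex ^ 2 ^ 2) \<Rightarrow>
   int ^ 3 \<Rightarrow> complex \<Rightarrow> complex ^ 2 ^ 2" where
  "fuchsian \<Delta> C B p \<mu> = (1 / \<mu>) \<cdot> C p + (\<Sum>n\<in>UNIV. (1 / (\<mu> - 1 / \<Delta> n)) \<cdot> B n p)"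

definition C_form ::
  "(int ^ 3 \<Rightarrow> complex) \<Rightarrow> complex \<Rightarrow> complex \<Rightarrow> complex \<Rightarrow> int ^ 3 \<Rightarrow> complex ^ 2 ^ 2" where
  "C_form z b c d p =
     (1 / 2) \<cdot> mat2 (- b * z p - c / 2) (b * (z p)\<^sup>2 + c * z p + d)
                     (- b)              (b * z p + c / 2)"

definition B_form ::
  "(int ^ 3 \<Rightarrow> complex) \<Rightarrow> (3 \<Rightarrow> complex) \<Rightarrow> 3 \<Rightarrow> int ^ 3 \<Rightarrow> complex ^ 2 ^ 2" where
  "B_form z a n p =
     ((of_int (p $ n) - a n) / (fwd z n p + bwd z n p)) \<cdot>
        mat2 (fwd z n p) (- (fwd z n p * bwd z n p))
             (- 1)       (bwd z n p)
     + (a n / 2) \<cdot> mat 1"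

definition isomonodromy_constraint ::
  "(int ^ 3 \<Rightarrow> complex) \<Rightarrow> complex \<Rightarrow> complex \<Rightarrow> complex \<Rightarrow> (3 \<Rightarrow> complex) \<Rightarrow> bool" where
  "isomonodromy_constraint z b c d a \<longleftrightarrow>
     (\<forall>p. b * (z p)\<^sup>2 + c * z p + d =
        (\<Sum>n\<in>UNIV. 2 * (of_int (p $ n) - a n) *
           (fwd z n p * bwd z n p / (fwd z n p + bwd z n p))))"

end

theory Submission
  imports Defs
begin

text \<open>
  Isomonodromy is the compatibility of the differential equation \<open>d\<Phi>\<^sub>p/d\<mu> = A\<^sub>p \<Phi>\<^sub>p\<close> with the
  lattice steps \<open>\<Phi>\<^bsub>p+e\<^esub> = L \<Phi>\<^sub>p\<close>, that is, the gauge equation \<open>A\<^bsub>p+e\<^esub> L = dL/d\<mu> + L A\<^sub>p\<close>. Both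
  sides are rational in \<open>\<mu>\<close> and \<open>L\<close> is affine in \<open>\<mu>\<close>, so a partial fraction decomposition turns the
  gauge equation into finitely many matrix equations (\<open>gauge_residue_equations\<close>): at each finite pole
  \<open>s\<close>, the matrix \<open>L(s)\<close> intertwines the residues at \<open>p\<close> and \<open>p + e\<close>, and one further equation comes
  from \<open>\<mu> = \<infinity>\<close>. Both directions of the theorem are statements about these equations.

  For an isomonodromic solution, the equation at \<open>0\<close> makes \<open>C\<close> a unipotent conjugate of a constant
  matrix. At \<open>1/\<Delta>\<^sub>n\<close> the matrix \<open>L\<close> of a step in direction \<open>n\<close> has rank one, which exhibits a left and a
  right eigenvector of \<open>B\<^bsup>(n)\<^esup>\<close> with a common eigenvalue; this eigenvalue is constant on the lattice and
  equals \<open>a\<^sub>n/2\<close>. The trace of \<open>B\<^bsup>(n)\<^esup>\<close> counts the steps in direction \<open>n\<close>, so \<open>B\<^bsup>(n)\<^esup>\<close> is determined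
  (\<open>residue_at_0_eq_C_form\<close>, \<open>residue_at_lattice_pole_form\<close>). The equation at infinity forces the
  upper right entry of the sum of all residues to vanish, and this is the constraint
  (\<open>residue_sum_entry_12\<close>).

  Conversely, the cross-ratio relations imply the equations at the finite poles for the explicit
  residues, and with the constraint they imply the one at infinity (\<open>explicit_residue_equations\<close>).
  A wave function is then assembled from two pieces. The transition matrices from the base point
  exist because the steps in different directions commute (\<open>transition_matrices\<close>). At the
  base point one needs a fundamental matrix of a linear equation over any simply connected domain
  (\<open>linear_ode_simply_connected\<close>); it is obtained from power series on the disc and the Riemann
  mapping theorem. The gauge equation propagates the differential equation from the base point to the
  whole lattice (\<open>wave_branch_from_base_point\<close>). Analytic continuation works since two fundamental
  matrices differ by a constant factor (\<open>isomonodromic_from_residue_equations\<close>).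
\<close>

(* The dollar sign denotes only components of vectors below, not coefficients of power series. *)
no_notation fps_nth (infixl "$" 75)

section \<open>Two-by-two matrices and matrix-valued functions\<close>

lemma matrix_add_mult_distrib: "(X + Y) ** Z = X ** Z + Y ** Z"
  for X Y Z :: "'a::semiring_1 ^ 'n ^ 'n"
  by (simp add: matrix_matrix_mult_def vec_eq_iff distrib_right sum.distrib)

lemma matrix_minus_mult:
  fixes X Y :: "'a::ring_1 ^ 'n ^ 'n"
  shows "(- X) ** Y = - (X ** Y)"
  by (simp add: matrix_matrix_mult_def vec_eq_iff sum_negf)

lemma mat2_nth [simp]:
  "mat2 a b c d $ 1 $ 1 = a" "mat2 a b c d $ 1 $ 2 = b"
  "mat2 a b c d $ 2 $ 1 = c" "mat2 a b c d $ 2 $ 2 = d"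
  by (simp_all add: mat2_def)

lemma cscale_nth [simp]: "(c \<cdot> X) $ i $ j = c * X $ i $ j"
  by (simp add: cscale_def)

lemma matrix_mult_nth_2 [simp]:
  fixes X Y :: "complex ^ 2 ^ 2"
  shows "(X ** Y) $ i $ j = X $ i $ 1 * Y $ 1 $ j + X $ i $ 2 * Y $ 2 $ j"
  by (simp add: matrix_matrix_mult_def sum_2)

lemma mat_1_nth_2 [simp]:
  "(mat 1 :: complex ^ 2 ^ 2) $ 1 $ 1 = 1" "(mat 1 :: complex ^ 2 ^ 2) $ 1 $ 2 = 0"
  "(mat 1 :: complex ^ 2 ^ 2) $ 2 $ 1 = 0" "(mat 1 :: complex ^ 2 ^ 2) $ 2 $ 2 = 1"
  by (simp_all add: mat_def)

lemma matrix_eq_2_iff: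
  fixes X Y :: "'a ^ 2 ^ 2"
  shows "X = Y \<longleftrightarrow> X $ 1 $ 1 = Y $ 1 $ 1 \<and> X $ 1 $ 2 = Y $ 1 $ 2 \<and>
                   X $ 2 $ 1 = Y $ 2 $ 1 \<and> X $ 2 $ 2 = Y $ 2 $ 2"
  by (auto simp: vec_eq_iff forall_2)

lemma trace_2: "trace (X :: complex ^ 2 ^ 2) = X $ 1 $ 1 + X $ 2 $ 2"
  by (simp add: trace_def sum_2)

text \<open>
  Used at the poles where the transition matrix is invertible: there a step on the lattice
  conjugates the residue.
\<close>

lemma similar_imp_trace_det_eq:
  fixes X Y L :: "complex ^ 'n ^ 'n"
  assumes "X ** L = L ** Y" and "invertible L"
  shows "trace X = trace Y" and "det X = det Y"
proof -
  obtain L' where L': "L ** L' = mat 1" "L' ** L = mat 1"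
    using assms(2) by (auto simp: invertible_def)
  have "X = X ** (L ** L')"
    by (simp add: L')
  also have "\<dots> = L ** (Y ** L')"
    by (simp add: assms(1) matrix_mul_assoc)
  finally have X: "X = L ** (Y ** L')" .
  have "trace X = trace ((Y ** L') ** L)"
    unfolding X by (rule trace_mul_sym)
  then show "trace X = trace Y"
    by (simp add: L' flip: matrix_mul_assoc)
  have "det X * det L = det L * det Y"
    using assms(1) det_mul by metis
  then show "det X = det Y"
    using assms(2) by (simp add: invertible_det_nz)
qed

lemma matrix_mult_derivative:
  fixes X Y :: "complex \<Rightarrow> complex ^ 'n ^ 'n"
  assumes "\<And>i j. ((\<lambda>x. X x $ i $ j) has_field_derivative X' $ i $ j) (at x)"
    and "\<And>i j. ((\<lambda>x. Y x $ i $ j) has_field_derivative Y' $ i $ j) (at x)"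
  shows "((\<lambda>x. (X x ** Y x) $ i $ j) has_field_derivative (X' ** Y x + X x ** Y') $ i $ j) (at x)"
  unfolding matrix_matrix_mult_def
  by (auto intro!: derivative_eq_intros assms simp: sum.distrib mult.commute)

lemma matrix_derivative_zero_imp_constant:
  fixes X :: "complex \<Rightarrow> complex ^ 'n ^ 'n"
  assumes "open D" "connected D"
    and "\<And>x i j. x \<in> D \<Longrightarrow> ((\<lambda>x. X x $ i $ j) has_field_derivative 0) (at x)"
  shows "\<exists>K. \<forall>x\<in>D. X x = K"
proof -
  have "\<exists>c. \<forall>x\<in>D. X x $ i $ j = c" for i j
  proof -
    have d: "((\<lambda>x. X x $ i $ j) has_field_derivative 0) (at x)" if "x \<in> D" for x
      by (rule assms(3)[OF that])
    then have "continuous_on D (\<lambda>x. X x $ i $ j)"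
      by (intro continuous_at_imp_continuous_on ballI) (rule DERIV_isCont)
    then obtain c where "\<And>x. x \<in> D \<Longrightarrow> X x $ i $ j = c"
      using DERIV_zero_connected_constant[of D "{}" "\<lambda>x. X x $ i $ j"] assms(1,2) d by auto
    then show ?thesis by blast
  qed
  then obtain c where "\<And>i j x. x \<in> D \<Longrightarrow> X x $ i $ j = c i j"
    by metis
  then show ?thesis
    by (intro exI[of _ "\<chi> i j. c i j"]) (simp add: vec_eq_iff)
qed

section \<open>Linear differential equations on simply connected domains\<close>

text \<open>
  The majorant argument behind the convergence of the power series of an ODE. The convolution
  with a geometric sequence of ratio \<open>\<rho> / r < 1\<close> costs only a bounded factor \<open>G\<close>, while the
  recurrence divides by \<open>k + 1\<close>. Hence the rescaled terms \<open>N k * \<rho> ^ k\<close> cannot grow once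
  \<open>k + 1 \<ge> G\<close>, and they are bounded by their maximum up to that index.
\<close>

lemma convolution_recurrence_bounded:
  fixes N :: "nat \<Rightarrow> real"
  assumes N: "\<And>k. 0 \<le> N k" and M: "0 \<le> M" and \<rho>: "0 < \<rho>" "\<rho> < r"
    and rec: "\<And>k. real (Suc k) * N (Suc k) \<le> (\<Sum>l\<le>k. M * (1 / r) ^ l * N (k - l))"
  shows "\<exists>K. \<forall>k. N k * \<rho> ^ k \<le> K"
proof -
  \<comment> \<open>The sum of the geometric series with ratio \<open>\<rho> / r\<close>, times \<open>\<rho> M\<close>.\<close>
  define G where "G = \<rho> * M / (1 - \<rho> / r)"
  obtain k0 :: nat where k0: "G \<le> real k0"
    using real_arch_simple by blast
  define K where "K = Max ((\<lambda>k. N k * \<rho> ^ k) ` {..k0})"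
  have small: "N k * \<rho> ^ k \<le> K" if "k \<le> k0" for k
    unfolding K_def using that by (intro Max_ge) auto
  have K0: "0 \<le> K"
    using small[of 0] N[of 0] by simp
  have q: "0 < \<rho> / r" "\<rho> / r < 1" and r: "0 < r"
    using \<rho> by auto
  have "N k * \<rho> ^ k \<le> K" for k
  proof (induction k rule: less_induct)
    case (less k)
    show ?case
    proof (cases "k \<le> k0")
      case False
      then obtain m where m: "k = Suc m" "k0 \<le> m"
        by (cases k) auto
      have "real (Suc m) * (N k * \<rho> ^ k) = (real (Suc m) * N (Suc m)) * \<rho> ^ Suc m"
        using m by simp
      also have "\<dots> \<le> (\<Sum>l\<le>m. M * (1 / r) ^ l * N (m - l)) * \<rho> ^ Suc m"
        using rec[of m] \<rho> by (intro mult_right_mono) auto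
      also have "\<dots> = (\<Sum>l\<le>m. \<rho> * M * (\<rho> / r) ^ l * (N (m - l) * \<rho> ^ (m - l)))"
        unfolding sum_distrib_right
      proof (rule sum.cong[OF refl])
        fix l assume "l \<in> {..m}"
        then have "\<rho> ^ Suc m = \<rho> * \<rho> ^ l * \<rho> ^ (m - l)"
          by (simp flip: power_add)
        then show "M * (1 / r) ^ l * N (m - l) * \<rho> ^ Suc m
            = \<rho> * M * (\<rho> / r) ^ l * (N (m - l) * \<rho> ^ (m - l))"
          by (simp add: power_divide)
      qed
      also have "\<dots> \<le> (\<Sum>l\<le>m. \<rho> * M * (\<rho> / r) ^ l * K)"
        using M \<rho> q m by (intro sum_mono mult_left_mono less.IH) auto
      also have "\<dots> = \<rho> * M * K * (\<Sum>l\<le>m. (\<rho> / r) ^ l)"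
        by (simp add: sum_distrib_left mult_ac)
      also have "\<dots> \<le> \<rho> * M * K * (1 / (1 - \<rho> / r))"
      proof (rule mult_left_mono)
        show "(\<Sum>l\<le>m. (\<rho> / r) ^ l) \<le> 1 / (1 - \<rho> / r)"
          using q sum_le_suminf[OF summable_geometric[of "\<rho> / r"], of "{..m}"]
          by (simp add: suminf_geometric)
      qed (use M K0 \<rho> in auto)
      also have "\<dots> = G * K"
        by (simp add: G_def)
      also have "\<dots> \<le> real (Suc m) * K"
        using k0 m K0 by (intro mult_right_mono) auto
      finally show ?thesis
        by (simp del: of_nat_Suc)
    qed (use small in auto)
  qed
  then show ?thesis by blast
qed

text \<open>
  The Taylor coefficients at \<open>0\<close> of the solution of \<open>y' = F y\<close>, \<open>y(0) = v\<close>, obtained by comparing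
  the coefficients of \<open>x\<^sup>k\<close> on both sides.
\<close>

fun ode_coeff :: "('n::finite \<Rightarrow> 'n \<Rightarrow> complex fps) \<Rightarrow> ('n \<Rightarrow> complex) \<Rightarrow> nat \<Rightarrow> 'n \<Rightarrow> complex" where
  "ode_coeff F v 0 i = v i"
| "ode_coeff F v (Suc k) i =
     (\<Sum>l\<le>k. \<Sum>j\<in>UNIV. fps_nth (F i j) l * ode_coeff F v (k - l) j) / of_nat (Suc k)"

lemma fps_nth_ode_coeff_bounded:
  fixes F :: "'n::finite \<Rightarrow> 'n \<Rightarrow> complex fps"
  assumes F: "\<And>i j. ereal r < fps_conv_radius (F i j)" and \<rho>: "0 < \<rho>" "\<rho> < r"
  shows "\<exists>K. \<forall>k i. norm (ode_coeff F v k i) * \<rho> ^ k \<le> K"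
proof -
  have r: "0 < r" using \<rho> by simp
  have "\<exists>c. \<forall>l. norm (fps_nth (F i j) l) \<le> c * (1 / r) ^ l" for i j
  proof -
    have "summable (\<lambda>l. fps_nth (F i j) l * of_real r ^ l)"
      using F[of i j] r by (intro summable_fps) auto
    then have "Bseq (\<lambda>l. fps_nth (F i j) l * of_real r ^ l)"
      using summable_LIMSEQ_zero convergentI convergent_imp_Bseq by blast
    then obtain c where "\<And>l. norm (fps_nth (F i j) l * of_real r ^ l) \<le> c"
      by (auto simp: Bseq_def)
    then have "norm (fps_nth (F i j) l) * r ^ l \<le> c" for l
      using r by (simp add: norm_mult norm_power)
    then show ?thesis
      using r by (auto intro!: exI[of _ c] simp: power_divide field_simps)
  qed
  then obtain c where c: "\<And>i j l. norm (fps_nth (F i j) l) \<le> c i j * (1 / r) ^ l"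
    by metis
  have c0: "0 \<le> c i j" for i j
    using order_trans[OF norm_ge_zero c[of i j 0]] by simp
  define N where "N k = (\<Sum>i\<in>UNIV. norm (ode_coeff F v k i))" for k
  define M where "M = (\<Sum>i\<in>UNIV. \<Sum>j\<in>UNIV. c i j)"
  have N_ge: "norm (ode_coeff F v k i) \<le> N k" for k i
    unfolding N_def by (rule member_le_sum) auto
  have "real (Suc k) * N (Suc k) \<le> (\<Sum>l\<le>k. M * (1 / r) ^ l * N (k - l))" for k
  proof -
    have "real (Suc k) * N (Suc k)
        = (\<Sum>i\<in>UNIV. norm (\<Sum>l\<le>k. \<Sum>j\<in>UNIV. fps_nth (F i j) l * ode_coeff F v (k - l) j))"
      unfolding N_def sum_distrib_left by (simp add: norm_divide del: of_nat_Suc)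
    also have "\<dots> \<le> (\<Sum>i\<in>UNIV. \<Sum>l\<le>k. \<Sum>j\<in>UNIV. c i j * (1 / r) ^ l * N (k - l))"
      using c c0 N_ge r
      by (intro sum_mono order_trans[OF norm_sum] order_trans[OF norm_mult_ineq] mult_mono) auto
    also have "\<dots> = (\<Sum>l\<le>k. M * (1 / r) ^ l * N (k - l))"
      unfolding M_def by (subst sum.swap) (simp add: sum_distrib_left sum_distrib_right)
    finally show ?thesis .
  qed
  then obtain K where "\<And>k. N k * \<rho> ^ k \<le> K"
    using convolution_recurrence_bounded[of N M \<rho> r] \<rho> c0
    by (auto simp: N_def M_def sum_nonneg)
  then have "norm (ode_coeff F v k i) * \<rho> ^ k \<le> K" for k i
    using \<rho> order_trans[OF mult_right_mono[OF N_ge]] by fastforce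
  then show ?thesis by blast
qed

lemma fps_conv_radius_ode_coeff:
  fixes F :: "'n::finite \<Rightarrow> 'n \<Rightarrow> complex fps"
  assumes F: "\<And>i j. R \<le> fps_conv_radius (F i j)"
  shows "R \<le> fps_conv_radius (Abs_fps (\<lambda>k. ode_coeff F v k i))"
  unfolding fps_conv_radius_def
proof (rule conv_radius_geI_ex')
  fix r0 :: real assume r0: "0 < r0" "ereal r0 < R"
  obtain r where r: "r0 < r" "ereal r < R"
    using ereal_dense2[OF r0(2)] by auto
  obtain \<rho> where \<rho>: "r0 < \<rho>" "\<rho> < r"
    using dense[OF r(1)] by auto
  obtain K where K: "\<And>k. norm (ode_coeff F v k i) * \<rho> ^ k \<le> K"
    using fps_nth_ode_coeff_bounded[of r F \<rho> v] F r \<rho> r0 by (meson less_le_trans order.strict_trans)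
  show "summable (\<lambda>k. fps_nth (Abs_fps (\<lambda>k. ode_coeff F v k i)) k * of_real r0 ^ k)"
  proof (rule summable_comparison_test')
    show "summable (\<lambda>k. K * (r0 / \<rho>) ^ k)"
      using r0 \<rho> by (intro summable_mult summable_geometric) auto
    show "norm (fps_nth (Abs_fps (\<lambda>k. ode_coeff F v k i)) k * of_real r0 ^ k) \<le> K * (r0 / \<rho>) ^ k"
      for k
      using mult_right_mono[OF K[of k], of "(r0 / \<rho>) ^ k"] r0 \<rho>
      by (simp add: norm_mult norm_power power_divide)
  qed
qed

lemma eval_fps_sum:
  fixes f :: "'b \<Rightarrow> 'a :: {banach, real_normed_div_algebra} fps"
  assumes "finite I" and "\<And>i. i \<in> I \<Longrightarrow> ereal (norm x) < fps_conv_radius (f i)"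
  shows "ereal (norm x) < fps_conv_radius (sum f I) \<and>
         eval_fps (sum f I) x = (\<Sum>i\<in>I. eval_fps (f i) x)"
  using assms
proof (induction I rule: finite_induct)
  case (insert i I)
  then have "ereal (norm x) < min (fps_conv_radius (f i)) (fps_conv_radius (sum f I))"
    by simp
  then have "ereal (norm x) < fps_conv_radius (f i + sum f I)"
    using fps_conv_radius_add less_le_trans by blast
  with insert show ?case by (simp add: eval_fps_add)
qed auto

text \<open>
  A linear equation has no movable singularities: its power series solution converges on every
  disc on which the coefficients are holomorphic. Allowing \<open>R = \<infinity>\<close> covers the whole plane.
  The columns of \<open>Y\<close> are the solutions whose initial values are the unit vectors.
\<close>

lemma linear_ode_solution_on_disc:
  fixes A :: "complex \<Rightarrow> complex ^ 'n ^ 'n"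
  assumes A: "\<And>i j. (\<lambda>x. A x $ i $ j) holomorphic_on eball 0 R" 
  shows "\<exists>Y. Y 0 = mat 1 \<and>
      (\<forall>x\<in>eball 0 R. \<forall>i j. ((\<lambda>x. Y x $ i $ j) has_field_derivative (A x ** Y x) $ i $ j) (at x))"
proof -
  define F where "F i j = fps_expansion (\<lambda>x. A x $ i $ j) 0" for i j
  have F: "R \<le> fps_conv_radius (F i j)" for i j
    unfolding F_def by (rule conv_radius_fps_expansion[OF A])
  have F_eval: "eval_fps (F i j) x = A x $ i $ j" if "x \<in> eball 0 R" for i j x
    unfolding F_def using eval_fps_expansion[OF A that] by simp
  define y where "y j i = Abs_fps (\<lambda>k. ode_coeff F (\<lambda>i. if i = j then 1 else 0) k i)" for i j
  have y: "R \<le> fps_conv_radius (y j i)" for i j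
    unfolding y_def by (rule fps_conv_radius_ode_coeff[OF F])
  have y_deriv: "fps_deriv (y j i) = (\<Sum>m\<in>UNIV. F i m * y j m)" for i j
  proof (rule fps_ext)
    fix k
    show "fps_nth (fps_deriv (y j i)) k = fps_nth (\<Sum>m\<in>UNIV. F i m * y j m) k"
      by (simp add: y_def fps_sum_nth fps_mult_nth field_simps atLeast0AtMost del: of_nat_Suc)
        (rule sum.swap)
  qed
  define Y where "Y x = (\<chi> i j. eval_fps (y j i) x)" for x
  have "((\<lambda>x. Y x $ i $ j) has_field_derivative (A x ** Y x) $ i $ j) (at x)"
    if x: "x \<in> eball 0 R" for x i j
  proof -
    have xF: "norm x < fps_conv_radius (F i j)" and xy: "norm x < fps_conv_radius (y j i)" for i j
      using F[of i j] y[of j i] x by (auto simp: in_eball_iff)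
    have xFy: "norm x < fps_conv_radius (F i m * y j m)" for m
      using xF xy by (intro less_le_trans[OF _ fps_conv_radius_mult]) simp
    have "eval_fps (fps_deriv (y j i)) x = (\<Sum>m\<in>UNIV. eval_fps (F i m) x * eval_fps (y j m) x)"
      unfolding y_deriv using eval_fps_sum[of UNIV x "\<lambda>m. F i m * y j m"] xFy xF xy
      by (simp add: eval_fps_mult)
    also have "\<dots> = (A x ** Y x) $ i $ j"
      by (simp add: matrix_matrix_mult_def Y_def F_eval[OF x])
    finally show ?thesis
      using has_field_derivative_eval_fps[OF xy, of j i UNIV] by (simp add: Y_def)
  qed
  moreover have "Y 0 = mat 1"
    by (simp add: Y_def y_def mat_def vec_eq_iff eval_fps_at_0)
  ultimately show ?thesis by blast
qed

text \<open>
  A fundamental matrix \<open>Y\<close> together with its inverse \<open>Z\<close>. The inverse is carried along because it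
  solves the adjoint equation \<open>Z' = - Z A\<close>, so that its derivative is available without
  differentiating a matrix inverse.
\<close>

definition fundamental_pair ::
  "(complex \<Rightarrow> complex ^ 'n ^ 'n) \<Rightarrow> complex set \<Rightarrow> (complex \<Rightarrow> complex ^ 'n ^ 'n) \<Rightarrow>
   (complex \<Rightarrow> complex ^ 'n ^ 'n) \<Rightarrow> bool" where
  "fundamental_pair A D Y Z \<longleftrightarrow> (\<forall>x\<in>D. Z x ** Y x = mat 1 \<and>
     (\<forall>i j. ((\<lambda>x. Y x $ i $ j) has_field_derivative (A x ** Y x) $ i $ j) (at x) \<and>
            ((\<lambda>x. Z x $ i $ j) has_field_derivative (- (Z x ** A x)) $ i $ j) (at x)))"

text \<open>
  The adjoint equation, transposed, is again a linear equation of the same kind, so it has a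
  solution \<open>Z\<close> with \<open>Z(0) = 1\<close>. Then \<open>(Z Y)' = - Z A Y + Z A Y = 0\<close>, and \<open>Z Y = 1\<close> holds on the
  whole disc because it holds at the centre.
\<close>

lemma fundamental_pair_on_disc:
  fixes A :: "complex \<Rightarrow> complex ^ 'n ^ 'n"
  assumes A: "\<And>i j. (\<lambda>x. A x $ i $ j) holomorphic_on eball 0 R" and R: "0 < R"
  shows "\<exists>Y Z. fundamental_pair A (eball 0 R) Y Z"
proof -
  obtain Y where Y0: "Y 0 = mat 1"
    and Y: "\<And>x i j. x \<in> eball 0 R \<Longrightarrow>
      ((\<lambda>x. Y x $ i $ j) has_field_derivative (A x ** Y x) $ i $ j) (at x)"
    using linear_ode_solution_on_disc[OF A] by metis
  have "(\<lambda>x. (- transpose (A x)) $ i $ j) holomorphic_on eball 0 R" for i j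
    using A[of j i] by (simp add: transpose_def holomorphic_on_minus)
  from linear_ode_solution_on_disc[OF this] obtain W where W0: "W 0 = mat 1"
    and W: "\<And>x i j. x \<in> eball 0 R \<Longrightarrow>
      ((\<lambda>x. W x $ i $ j) has_field_derivative (- transpose (A x) ** W x) $ i $ j) (at x)"
    by metis
  define Z where "Z x = transpose (W x)" for x
  have Z: "((\<lambda>x. Z x $ i $ j) has_field_derivative (- (Z x ** A x)) $ i $ j) (at x)"
    if "x \<in> eball 0 R" for x i j
    using W[OF that, of j i]
    by (simp add: Z_def transpose_def matrix_matrix_mult_def sum_negf mult.commute)
  have "((\<lambda>x. (Z x ** Y x) $ i $ j) has_field_derivative 0) (at x)" if "x \<in> eball 0 R" for x i j
    using matrix_mult_derivative[OF Z[OF that] Y[OF that], of i j]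
    by (simp add: matrix_mul_assoc matrix_minus_mult)
  then obtain K where K: "\<And>x. x \<in> eball 0 R \<Longrightarrow> Z x ** Y x = K"
    using matrix_derivative_zero_imp_constant[of "eball 0 R" "\<lambda>x. Z x ** Y x"]
    by (auto simp: connected_eball simp del: in_eball_iff)
  have "K = mat 1"
    using K[of 0] R Y0 W0 by (simp add: Z_def in_eball_iff zero_ereal_def)
  with K Y Z show ?thesis
    unfolding fundamental_pair_def by blast
qed

text \<open>
  The Riemann mapping theorem reduces the claim to the disc: with \<open>f\<close> a biholomorphic map from \<open>D\<close>
  to the disc and \<open>g\<close> its inverse, the pulled-back equation has the coefficient matrix
  \<open>P = (A \<circ> g) g'\<close>, and \<open>Y \<circ> f\<close> solves the original one since \<open>g'(f x) f'(x) = 1\<close>.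
\<close>

lemma linear_ode_simply_connected:
  fixes A :: "complex \<Rightarrow> complex ^ 'n ^ 'n"
  assumes D: "open D" "simply_connected D"
    and A: "\<And>i j. (\<lambda>x. A x $ i $ j) holomorphic_on D"
  shows "\<exists>Y Z. fundamental_pair A D Y Z"
proof -
  consider "D = {}" | "D = UNIV"
    | f g where "f holomorphic_on D" "g holomorphic_on ball 0 1"
      "\<And>x. x \<in> D \<Longrightarrow> f x \<in> ball 0 1 \<and> g (f x) = x"
      "\<And>w. w \<in> ball 0 1 \<Longrightarrow> g w \<in> D \<and> f (g w) = w"
    using Riemann_mapping_theorem[of D] D by auto
  then show ?thesis
  proof cases
    case 1
    then show ?thesis by (simp add: fundamental_pair_def)
  next
    case 2
    then show ?thesis
      using fundamental_pair_on_disc[of A \<infinity>] A by (simp add: eball_inf)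
  next
    case (3 f g)
    have [simp]: "eball (0::complex) 1 = ball 0 1"
      using eball_ereal[of 0 1] by (simp add: one_ereal_def)
    define P where "P w = (\<chi> i j. A (g w) $ i $ j * deriv g w)" for w
    have "(\<lambda>w. P w $ i $ j) holomorphic_on eball 0 1" for i j
    proof -
      have "(\<lambda>w. A (g w) $ i $ j) holomorphic_on ball 0 1"
        using holomorphic_on_compose_gen[OF 3(2) A, of i j] 3(4) by (force simp: o_def)
      then show ?thesis
        using holomorphic_deriv[OF 3(2)] by (auto simp: P_def intro!: holomorphic_intros)
    qed
    from fundamental_pair_on_disc[OF this] obtain Y Z where YZ: "fundamental_pair P (ball 0 1) Y Z"
      by auto
    have "fundamental_pair A D (\<lambda>x. Y (f x)) (\<lambda>x. Z (f x))"
      unfolding fundamental_pair_def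
    proof (intro ballI conjI allI)
      fix x assume x: "x \<in> D"
      then have fx: "f x \<in> ball 0 1" "g (f x) = x" using 3 by auto
      show "Z (f x) ** Y (f x) = mat 1"
        using YZ fx by (auto simp: fundamental_pair_def)
      have f': "(f has_field_derivative deriv f x) (at x)"
        by (rule holomorphic_derivI[OF 3(1) D(1) x])
      have "((\<lambda>x. g (f x)) has_field_derivative deriv g (f x) * deriv f x) (at x)"
        by (rule DERIV_chain2[OF holomorphic_derivI[OF 3(2) open_ball fx(1)] f'])
      moreover have "((\<lambda>x. g (f x)) has_field_derivative 1) (at x)"
        by (rule has_field_derivative_transform_within_open[OF DERIV_ident D(1) x]) (use 3 in auto)
      ultimately have gf: "deriv g (f x) * deriv f x = 1"
        by (rule DERIV_unique)
      fix i j
      have "((\<lambda>x. Y (f x) $ i $ j) has_field_derivative (P (f x) ** Y (f x)) $ i $ j * deriv f x) (at x)"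
        using YZ fx f' by (auto simp: fundamental_pair_def intro!: DERIV_chain2[where f="\<lambda>w. Y w $ i $ j"])
      moreover have "(P (f x) ** Y (f x)) $ i $ j * deriv f x = (A x ** Y (f x)) $ i $ j * (deriv g (f x) * deriv f x)"
        by (simp add: P_def matrix_matrix_mult_def sum_distrib_right sum_distrib_left fx mult_ac)
      ultimately show "((\<lambda>x. Y (f x) $ i $ j) has_field_derivative (A x ** Y (f x)) $ i $ j) (at x)"
        by (simp add: gf)
      have "((\<lambda>x. Z (f x) $ i $ j) has_field_derivative (- (Z (f x) ** P (f x))) $ i $ j * deriv f x) (at x)"
        using YZ fx f' by (auto simp: fundamental_pair_def simp del: vector_uminus_component intro!: DERIV_chain2[where f="\<lambda>w. Z w $ i $ j"])
      moreover have "(- (Z (f x) ** P (f x))) $ i $ j * deriv f x = (- (Z (f x) ** A x)) $ i $ j * (deriv g (f x) * deriv f x)"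
        by (simp add: P_def matrix_matrix_mult_def sum_distrib_right sum_distrib_left fx mult_ac)
      ultimately show "((\<lambda>x. Z (f x) $ i $ j) has_field_derivative (- (Z (f x) ** A x)) $ i $ j) (at x)"
        by (simp add: gf)
    qed
    then show ?thesis by blast
  qed
qed

text \<open>
  Two solutions of a linear equation differ by a constant right factor where both are defined,
  because \<open>(Z \<Phi>)' = 0\<close>. This is what makes analytic continuation of wave functions possible.
\<close>

lemma fundamental_pair_comparison:
  fixes A \<Phi> :: "complex \<Rightarrow> complex ^ 'n ^ 'n"
  assumes YZ: "fundamental_pair A D' Y Z" and D: "open D" "connected D" "D \<subseteq> D'"
    and \<Phi>: "\<And>x i j. x \<in> D \<Longrightarrow> ((\<lambda>x. \<Phi> x $ i $ j) has_field_derivative (A x ** \<Phi> x) $ i $ j) (at x)"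
  shows "\<exists>K. \<forall>x\<in>D. \<Phi> x = Y x ** K"
proof -
  have "((\<lambda>x. (Z x ** \<Phi> x) $ i $ j) has_field_derivative 0) (at x)" if "x \<in> D" for x i j
  proof -
    have "((\<lambda>x. Z x $ i $ j) has_field_derivative (- (Z x ** A x)) $ i $ j) (at x)" for i j
      using YZ D(3) that unfolding fundamental_pair_def by blast
    from matrix_mult_derivative[OF this \<Phi>[OF that], of i j] show ?thesis
      by (simp add: matrix_mul_assoc matrix_minus_mult)
  qed
  from matrix_derivative_zero_imp_constant[OF D(1,2) this]
  obtain K where K: "\<forall>x\<in>D. Z x ** \<Phi> x = K"
    by blast
  have "\<Phi> x = Y x ** K" if "x \<in> D" for x
  proof -
    have "Z x ** Y x = mat 1"
      using YZ D(3) that unfolding fundamental_pair_def by blast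
    then have "Y x ** Z x = mat 1"
      by (rule matrix_left_right_inverse1)
    then have "\<Phi> x = (Y x ** Z x) ** \<Phi> x"
      by simp
    also have "\<dots> = Y x ** K"
      using K that by (simp flip: matrix_mul_assoc)
    finally show ?thesis .
  qed
  then show ?thesis by blast
qed

section \<open>Functions on the lattice\<close>

lemma int_shift_iff:
  fixes P :: "int \<Rightarrow> bool"
  assumes "\<And>k. P k \<longleftrightarrow> P (k + 1)"
  shows "P k \<longleftrightarrow> P 0"
proof (induction k rule: int_induct[where k = 0])
  case (step2 i)
  then show ?case using assms[of "i - 1"] by simp
qed (use assms in auto)

text \<open>
  Induction over \<open>\<int>\<^sup>n\<close> has to go forward and backward along every axis, hence the equivalence in
  the induction step.
\<close>

lemma lattice_induct:
  fixes p :: "int ^ 'n"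
  assumes 0: "P 0" and shift: "\<And>p n. P p \<longleftrightarrow> P (p + axis n 1)"
  shows "P p"
proof -
  have line: "P (q + axis n k) \<longleftrightarrow> P q" for q n k
  proof -
    have "P (q + axis n k) \<longleftrightarrow> P (q + axis n (k + 1))" for k
    proof -
      have "q + axis n (k + 1) = q + axis n k + axis n 1"
        by (simp add: vec_eq_iff axis_def)
      then show ?thesis using shift[of "q + axis n k" n] by (simp add: add.assoc)
    qed
    then have "P (q + axis n k) \<longleftrightarrow> P (q + axis n 0)"
      by (rule int_shift_iff)
    moreover have "axis n 0 = (0 :: int ^ 'n)"
      by (simp add: vec_eq_iff axis_def)
    ultimately show ?thesis by simp
  qed
  have "P (\<Sum>n\<in>I. axis n (p $ n))" if "finite I" for I
    using that by (induction I rule: finite_induct) (simp_all add: 0 line add.commute[of "axis _ _"])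
  moreover have "(\<Sum>n\<in>UNIV. axis n (p $ n)) = p"
    by (simp add: vec_eq_iff axis_def if_distrib cong: if_cong)
  ultimately show ?thesis
    using finite by metis
qed

corollary lattice_constant:
  fixes p :: "int ^ 'n"
  assumes "\<And>p n. F (p + axis n 1) = F p"
  shows "F p = F 0"
  by (rule lattice_induct[of "\<lambda>p. F p = F 0"]) (simp_all add: assms)

lemma bij_int_iterate:
  assumes "bij f"
  shows "\<exists>h :: int \<Rightarrow> 'a \<Rightarrow> 'a. h 0 = id \<and> (\<forall>k. h (k + 1) = f \<circ> h k)"
proof -
  define h where "h k = (if 0 \<le> k then f ^^ nat k else inv f ^^ nat (- k))" for k :: int
  have "h (k + 1) = f \<circ> h k" for k
  proof (cases "0 \<le> k")
    case True
    then show ?thesis by (simp add: h_def nat_add_distrib)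
  next
    case False
    then have k: "nat (- k) = Suc (nat (- (k + 1)))" by simp
    have "f \<circ> h k = f \<circ> inv f \<circ> inv f ^^ nat (- (k + 1))"
      using False unfolding h_def k by (simp add: o_assoc)
    also have "\<dots> = inv f ^^ nat (- (k + 1))"
      using assms by (simp only: bij_is_surj surj_iff[THEN iffD1] id_comp)
    also have "\<dots> = h (k + 1)"
      using False by (auto simp: h_def)
    finally show ?thesis by simp
  qed
  then show ?thesis
    by (intro exI[of _ h]) (simp add: h_def id_def)
qed

lemma int_iterate_commute:
  fixes h :: "int \<Rightarrow> 'a \<Rightarrow> 'a"
  assumes "h 0 = id" and "\<And>k. h (k + 1) = f \<circ> h k" and "bij f" and "g \<circ> f = f \<circ> g"
  shows "g (h k x) = h k (g x)"
proof -
  have "g \<circ> h k = h k \<circ> g \<longleftrightarrow> g \<circ> h (k + 1) = h (k + 1) \<circ> g" for k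
  proof -
    have "g \<circ> h (k + 1) = f \<circ> (g \<circ> h k)" "h (k + 1) \<circ> g = f \<circ> (h k \<circ> g)"
      using assms(4) by (simp_all add: assms(2) o_assoc)
    moreover have "f \<circ> a = f \<circ> b \<longleftrightarrow> a = b" for a b :: "'a \<Rightarrow> 'a"
      using assms(3) by (auto simp: fun_eq_iff bij_def inj_eq)
    ultimately show ?thesis by simp
  qed
  then have "g \<circ> h k = h k \<circ> g \<longleftrightarrow> g \<circ> h 0 = h 0 \<circ> g"
    by (rule int_shift_iff)
  then show ?thesis
    using assms(1) by (simp add: fun_eq_iff)
qed

text \<open>
  Three commuting bijections form an action of \<open>\<int>\<^sup>3\<close>; \<open>\<psi>\<close> is the orbit of \<open>x\<close>. This is how zero
  curvature (commuting transition matrices) yields a wave function on the lattice.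
\<close>

lemma commuting_bijections_orbit:
  fixes \<sigma> :: "3 \<Rightarrow> 'a \<Rightarrow> 'a"
  assumes bij: "\<And>n. bij (\<sigma> n)" and comm: "\<And>n m. \<sigma> n \<circ> \<sigma> m = \<sigma> m \<circ> \<sigma> n"
  shows "\<exists>\<psi>. \<psi> 0 = x \<and> (\<forall>p n. \<psi> (p + step n) = \<sigma> n (\<psi> p))"
proof -
  obtain h :: "3 \<Rightarrow> int \<Rightarrow> 'a \<Rightarrow> 'a"
    where h: "\<And>n. h n 0 = id" "\<And>n k. h n (k + 1) = \<sigma> n \<circ> h n k"
    using bij_int_iterate[OF bij] by metis
  have hc: "\<sigma> m (h n k y) = h n k (\<sigma> m y)" for m n k y
    by (rule int_iterate_commute[OF h bij comm])
  define \<psi> where "\<psi> p = h 1 (p $ 1) (h 2 (p $ 2) (h 3 (p $ 3) x))" for p :: "int ^ 3"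
  have "\<psi> (p + step n) = \<sigma> n (\<psi> p)" for p n
    using exhaust_3[of n] by (elim disjE) (simp_all add: \<psi>_def axis_def h(2) hc)
  moreover have "\<psi> 0 = x"
    by (simp add: \<psi>_def h(1))
  ultimately show ?thesis by blast
qed

section \<open>Sums of simple fractions\<close>

lemma sum_option: "(\<Sum>i\<in>UNIV. f i) = f None + (\<Sum>n\<in>UNIV. f (Some n))"
  for f :: "'n::finite option \<Rightarrow> 'a::comm_monoid_add"
  by (simp add: UNIV_option_conv sum.reindex)

text \<open>
  After clearing denominators the identity says that a polynomial has infinitely many roots, hence
  vanishes; its value at \<open>s i\<close> is \<open>c i\<close> times a nonzero factor.
\<close>

lemma partial_fraction_unique:
  fixes s c :: "'i \<Rightarrow> 'a::field" and k :: 'a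
  assumes "finite I" and "inj_on s I" and "infinite U"
    and zero: "\<And>x. x \<in> U \<Longrightarrow> x \<notin> s ` I \<and> k + (\<Sum>i\<in>I. c i / (x - s i)) = 0"
  shows "k = 0" and "\<forall>i\<in>I. c i = 0"
proof -
  \<comment> \<open>The left-hand side times the product of all \<open>x - s i\<close>.\<close>
  define P where "P = smult k (\<Prod>i\<in>I. [:- s i, 1:]) + (\<Sum>i\<in>I. smult (c i) (\<Prod>j\<in>I - {i}. [:- s j, 1:]))"
  have "poly P x = 0" if "x \<in> U" for x
  proof -
    have x: "x - s i \<noteq> 0" if "i \<in> I" for i
      using zero[OF \<open>x \<in> U\<close>] that by auto
    have "c i * (\<Prod>j\<in>I - {i}. x - s j) = (\<Prod>j\<in>I. x - s j) * (c i / (x - s i))" if "i \<in> I" for i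
      using x[OF that] by (subst prod.remove[OF assms(1) that]) simp
    then have "poly P x = (\<Prod>j\<in>I. x - s j) * (k + (\<Sum>i\<in>I. c i / (x - s i)))"
      by (simp add: P_def poly_prod poly_sum distrib_left sum_distrib_left mult.commute)
    then show ?thesis using zero[OF that] by simp
  qed
  then have "P = 0"
    using poly_roots_finite[of P] assms(3) finite_subset[of U "{x. poly P x = 0}"] by blast
  show c: "\<forall>i\<in>I. c i = 0"
  proof
    fix i assume i: "i \<in> I"
    have "poly P (s i) = c i * (\<Prod>j\<in>I - {i}. s i - s j)"
    proof -
      have "(\<Sum>m\<in>I. c m * (\<Prod>j\<in>I - {m}. s i - s j)) = (\<Sum>m\<in>{i}. c m * (\<Prod>j\<in>I - {m}. s i - s j))"
        using assms(1) i by (intro sum.mono_neutral_right) auto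
      moreover have "(\<Prod>j\<in>I. s i - s j) = 0"
        using assms(1) i by auto
      ultimately show ?thesis
        by (simp add: P_def poly_prod poly_sum)
    qed
    moreover have "(\<Prod>j\<in>I - {i}. s i - s j) \<noteq> 0"
      using assms(1,2) i by (auto simp: inj_on_def)
    ultimately show "c i = 0"
      using \<open>P = 0\<close> by simp
  qed
  obtain x where "x \<in> U"
    using assms(3) infinite_imp_nonempty by blast
  then show "k = 0"
    using zero[of x] c by simp
qed

text \<open>
  All poles are simple. If the residue at \<open>s i\<close> is zero, there is no pole: because \<open>0 / 0 = 0\<close>, the
  sum then coincides, also at the point \<open>s i\<close> itself, with a function continuous there.
\<close>

lemma simple_fraction_sum_pole:
  fixes s c :: "'i \<Rightarrow> complex"
  assumes "finite I" and "inj_on s I"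
  defines "f \<equiv> \<lambda>x. \<Sum>i\<in>I. c i / (x - s i)"
  assumes x: "is_pole f x"
  shows "x \<in> s ` I" and "zorder f x = - 1"
proof -
  \<comment> \<open>The part of the sum that is regular at \<open>x\<close>.\<close>
  define h where "h w = (\<Sum>i\<in>{i\<in>I. s i \<noteq> x}. c i / (w - s i))" for w
  define U where "U = - s ` {i\<in>I. s i \<noteq> x}"
  have U: "open U" "x \<in> U"
    using assms(1) by (auto simp: U_def intro!: open_Compl finite_imp_closed)
  have h: "h holomorphic_on U"
    unfolding h_def U_def by (intro holomorphic_intros) auto
  have "f \<noteq> h"
  proof
    assume "f = h"
    then have "isCont f x"
      using h U by (simp add: holomorphic_on_imp_continuous_on continuous_on_eq_continuous_at[symmetric]
          holomorphic_on_imp_continuous_on[THEN continuous_on_interior] interior_open)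
    then show False
      using x by (metis at_neq_bot isContD is_pole_def not_tendsto_and_filterlim_at_infinity)
  qed
  then obtain w where "f w \<noteq> h w"
    by blast
  moreover have f_split: "f w = h w + (\<Sum>i\<in>{i\<in>I. s i = x}. c i / (w - s i))" for w
    unfolding f_def h_def using assms(1)
    by (subst sum.union_disjoint[symmetric]) (auto intro!: sum.cong)
  ultimately have "(\<Sum>i\<in>{i\<in>I. s i = x}. c i / (w - s i)) \<noteq> 0"
    by simp
  then have "\<exists>i\<in>{i\<in>I. s i = x}. c i / (w - s i) \<noteq> 0"
    by (meson sum.neutral)
  then obtain i where i: "i \<in> I" "s i = x" "c i \<noteq> 0"
    by auto
  have "{i\<in>I. s i = x} = {i}"
    using i assms(2) by (auto simp: inj_on_def)
  then have f: "f w = h w + c i / (w - x)" for w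
    using f_split i by simp
  show "x \<in> s ` I"
    using i by blast
  show "zorder f x = - 1"
  proof (rule zorder_eqI[OF U])
    show "(\<lambda>w. h w * (w - x) + c i) holomorphic_on U"
      by (intro holomorphic_intros h)
    show "f w = (h w * (w - x) + c i) * (w - x) powi - 1" if "w \<in> U" "w \<noteq> x" for w
      using that by (simp add: f field_simps power_int_minus)
  qed (use i in simp)
qed

section \<open>The gauge equation and its residues\<close>

lemma nondegenerate_fwd: "nondegenerate z \<Longrightarrow> fwd z n p \<noteq> 0"
  by (simp add: nondegenerate_def fwd_def)

lemma bwd_shift: "bwd z n (p + step n) = fwd z n p"
  by (simp add: bwd_def fwd_def)

text \<open>
  The four finite poles of \<open>fuchsian\<close> are indexed uniformly: \<open>None\<close> stands for \<open>\<mu> = 0\<close>, where the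
  residue is \<open>C\<close>, and \<open>Some n\<close> for \<open>\<mu> = 1/\<Delta>\<^sub>n\<close>, where it is \<open>B\<^bsup>(n)\<^esup>\<close>.
\<close>

fun pole :: "(3 \<Rightarrow> complex) \<Rightarrow> 3 option \<Rightarrow> complex" where
  "pole \<Delta> None = 0"
| "pole \<Delta> (Some n) = 1 / \<Delta> n"

fun fuchsian_residue ::
  "(int ^ 3 \<Rightarrow> complex ^ 2 ^ 2) \<Rightarrow> (3 \<Rightarrow> int ^ 3 \<Rightarrow> complex ^ 2 ^ 2) \<Rightarrow> 3 option \<Rightarrow> int ^ 3 \<Rightarrow> complex ^ 2 ^ 2"
  where
  "fuchsian_residue C B None = C"
| "fuchsian_residue C B (Some n) = B n"

lemma fuchsian_eq_sum_residues:
  "fuchsian \<Delta> C B p \<mu> = (\<Sum>i\<in>UNIV. (1 / (\<mu> - pole \<Delta> i)) \<cdot> fuchsian_residue C B i p)"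
  by (simp add: fuchsian_def sum_option)

lemma inj_pole:
  assumes "\<And>n. \<Delta> n \<noteq> 0" and "inj \<Delta>"
  shows "inj (pole \<Delta>)"
proof (rule injI)
  fix i j assume "pole \<Delta> i = pole \<Delta> j"
  then show "i = j"
    using assms by (cases i; cases j) (auto simp: inj_eq)
qed

text \<open>
  The derivative of the transition matrix with respect to \<open>\<mu>\<close>.
\<close>

definition lax_slope :: "(3 \<Rightarrow> complex) \<Rightarrow> (int ^ 3 \<Rightarrow> complex) \<Rightarrow> 3 \<Rightarrow> int ^ 3 \<Rightarrow> complex ^ 2 ^ 2" where
  "lax_slope \<Delta> z n p = mat2 0 0 (\<Delta> n / fwd z n p) 0"

lemma lax_affine: "lax \<Delta> z n p \<mu> = lax \<Delta> z n p \<nu> + (\<mu> - \<nu>) \<cdot> lax_slope \<Delta> z n p"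
  by (simp add: matrix_eq_2_iff lax_def lax_slope_def flip: distrib_right add_divide_distrib)

lemma lax_derivative:
  "((\<lambda>\<mu>. lax \<Delta> z n p \<mu> $ i $ j) has_field_derivative lax_slope \<Delta> z n p $ i $ j) (at \<mu>)"
proof -
  define c where "c = \<Delta> n / fwd z n p"
  show ?thesis
    using exhaust_2[of i] exhaust_2[of j]
    by (elim disjE)
      (auto simp: lax_def lax_slope_def simp flip: c_def intro!: derivative_eq_intros)
qed

lemma invertible_lax:
  assumes "nondegenerate z" and "\<mu> * \<Delta> n \<noteq> 1"
  shows "invertible (lax \<Delta> z n p \<mu>)"
proof -
  have "fwd z n p \<noteq> 0"
    using assms(1) by (simp add: nondegenerate_def fwd_def)
  then show ?thesis
    using assms(2) by (simp add: invertible_det_nz det_2 lax_def)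
qed

text \<open>
  Partial fraction decomposition of \<open>A' L - dL/d\<mu> - L A\<close> for \<open>A = \<Sum>\<^sub>i R\<^sub>i / (\<mu> - s\<^sub>i)\<close> and
  \<open>A' = \<Sum>\<^sub>i R'\<^sub>i / (\<mu> - s\<^sub>i)\<close>. Since \<open>L(\<mu>) = L(s\<^sub>i) + (\<mu> - s\<^sub>i) Q\<close>, every summand splits into a
  multiple of \<open>1 / (\<mu> - s\<^sub>i)\<close> and a constant.
\<close>

lemma gauge_difference_expansion:
  fixes R R' :: "3 option \<Rightarrow> complex ^ 2 ^ 2"
  assumes \<mu>: "\<mu> \<notin> range (pole \<Delta>)"
  shows "(\<Sum>i\<in>UNIV. (1 / (\<mu> - pole \<Delta> i)) \<cdot> R' i) ** lax \<Delta> z n p \<mu>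
       - lax_slope \<Delta> z n p
       - lax \<Delta> z n p \<mu> ** (\<Sum>i\<in>UNIV. (1 / (\<mu> - pole \<Delta> i)) \<cdot> R i)
     = (sum R' UNIV ** lax_slope \<Delta> z n p - lax_slope \<Delta> z n p - lax_slope \<Delta> z n p ** sum R UNIV)
       + (\<Sum>i\<in>UNIV. (1 / (\<mu> - pole \<Delta> i)) \<cdot>
            (R' i ** lax \<Delta> z n p (pole \<Delta> i) - lax \<Delta> z n p (pole \<Delta> i) ** R i))"
proof -
  define Q where "Q = lax_slope \<Delta> z n p"
  define L where "L = lax \<Delta> z n p"
  have summand: "((1 / (\<mu> - pole \<Delta> i)) \<cdot> R' i) ** L \<mu> - L \<mu> ** ((1 / (\<mu> - pole \<Delta> i)) \<cdot> R i)
     = R' i ** Q - Q ** R i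
       + (1 / (\<mu> - pole \<Delta> i)) \<cdot> (R' i ** L (pole \<Delta> i) - L (pole \<Delta> i) ** R i)" for i
  proof -
    define e where "e = \<mu> - pole \<Delta> i"
    have e: "e \<noteq> 0" using \<mu> by (auto simp: e_def)
    have L: "L \<mu> = L (pole \<Delta> i) + e \<cdot> Q"
      unfolding L_def Q_def e_def by (rule lax_affine)
    show ?thesis
      unfolding e_def[symmetric] L
      using e by (simp add: matrix_eq_2_iff field_simps)
  qed
  have mult_sum: "sum X UNIV ** Y = (\<Sum>i\<in>UNIV. X i ** Y)" "Y ** sum X UNIV = (\<Sum>i\<in>UNIV. Y ** X i)"
    for X :: "3 option \<Rightarrow> complex ^ 2 ^ 2" and Y
    by (simp_all add: matrix_eq_2_iff sum_distrib_right sum_distrib_left sum.distrib)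
  show ?thesis
    using arg_cong[OF ext[OF summand], of "\<lambda>f. sum f UNIV - Q"]
    by (simp add: mult_sum sum.distrib sum_subtractf algebra_simps flip: Q_def L_def)
qed

lemma range_pole: "range (pole \<Delta>) = insert 0 (range (\<lambda>n. 1 / \<Delta> n))"
  by (simp add: UNIV_option_conv image_image)

lemma mult_eq_1_imp_pole: "\<mu> * \<Delta> n = 1 \<Longrightarrow> \<mu> \<in> range (pole \<Delta>)"
  by (auto simp: range_pole image_iff eq_divide_eq intro!: exI[of _ n])

lemma fuchsian_nth:
  "fuchsian \<Delta> C B p \<mu> $ i $ j = (\<Sum>k\<in>UNIV. fuchsian_residue C B k p $ i $ j / (\<mu> - pole \<Delta> k))"
  by (simp add: fuchsian_eq_sum_residues)

lemma fuchsian_holomorphic: "(\<lambda>\<mu>. fuchsian \<Delta> C B p \<mu> $ i $ j) holomorphic_on - range (pole \<Delta>)"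
  unfolding fuchsian_nth by (intro holomorphic_intros) auto

text \<open>
  The conditions that all terms in \<open>gauge_difference_expansion\<close> vanish: one equation per finite pole, and
  one from the constant term, that is, from \<open>\<mu> = \<infinity>\<close>.
\<close>

definition gauge_residue_equations ::
  "(3 \<Rightarrow> complex) \<Rightarrow> (int ^ 3 \<Rightarrow> complex) \<Rightarrow> (3 option \<Rightarrow> int ^ 3 \<Rightarrow> complex ^ 2 ^ 2) \<Rightarrow> bool" where
  "gauge_residue_equations \<Delta> z R \<longleftrightarrow> (\<forall>p n.
     (\<forall>i. R i (p + step n) ** lax \<Delta> z n p (pole \<Delta> i) = lax \<Delta> z n p (pole \<Delta> i) ** R i p) \<and>
     (\<Sum>i\<in>UNIV. R i (p + step n)) ** lax_slope \<Delta> z n p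
        = lax_slope \<Delta> z n p + lax_slope \<Delta> z n p ** (\<Sum>i\<in>UNIV. R i p))"

lemma gauge_residue_equationsD:
  assumes "gauge_residue_equations \<Delta> z R"
  shows "R i (p + step n) ** lax \<Delta> z n p (pole \<Delta> i) = lax \<Delta> z n p (pole \<Delta> i) ** R i p"
    and "(\<Sum>i\<in>UNIV. R i (p + step n)) ** lax_slope \<Delta> z n p
       = lax_slope \<Delta> z n p + lax_slope \<Delta> z n p ** (\<Sum>i\<in>UNIV. R i p)"
  using assms unfolding gauge_residue_equations_def by blast+

lemma gauge_equation_imp_residue_equations:
  assumes \<Delta>: "\<And>n. \<Delta> n \<noteq> 0" "inj \<Delta>" and U: "infinite U"
    and gauge: "\<And>p n \<mu>. \<mu> \<in> U \<Longrightarrow> \<mu> \<notin> range (pole \<Delta>) \<and>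
      fuchsian \<Delta> C B (p + step n) \<mu> ** lax \<Delta> z n p \<mu>
        = lax_slope \<Delta> z n p + lax \<Delta> z n p \<mu> ** fuchsian \<Delta> C B p \<mu>"
  shows "gauge_residue_equations \<Delta> z (fuchsian_residue C B)"
  unfolding gauge_residue_equations_def
proof (intro allI)
  fix p n
  define R where "R = fuchsian_residue C B"
  define Q where "Q = lax_slope \<Delta> z n p"
  define c where "c i = R i (p + step n) ** lax \<Delta> z n p (pole \<Delta> i)
    - lax \<Delta> z n p (pole \<Delta> i) ** R i p" for i
  define k where "k = (\<Sum>i\<in>UNIV. R i (p + step n)) ** Q - Q - Q ** (\<Sum>i\<in>UNIV. R i p)"
  have zero: "k + (\<Sum>i\<in>UNIV. (1 / (\<mu> - pole \<Delta> i)) \<cdot> c i) = 0" if "\<mu> \<in> U" for \<mu>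
  proof -
    have "fuchsian \<Delta> C B (p + step n) \<mu> ** lax \<Delta> z n p \<mu> - Q - lax \<Delta> z n p \<mu> ** fuchsian \<Delta> C B p \<mu> = 0"
      using gauge[OF that, of p n] by (simp add: Q_def)
    then show ?thesis
      using gauge_difference_expansion[of \<mu> \<Delta> "\<lambda>i. R i (p + step n)" z n p "\<lambda>i. R i p"]
        gauge[OF that, of p n]
      unfolding fuchsian_eq_sum_residues c_def k_def R_def Q_def by (simp only: simp_thms)
  qed
  have entry: "k $ a $ b = 0 \<and> (\<forall>i. c i $ a $ b = 0)" for a b
  proof -
    have "\<mu> \<notin> range (pole \<Delta>) \<and> k $ a $ b + (\<Sum>i\<in>UNIV. c i $ a $ b / (\<mu> - pole \<Delta> i)) = 0"
      if "\<mu> \<in> U" for \<mu>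
      using arg_cong[OF zero[OF that], of "\<lambda>X. X $ a $ b"] gauge[OF that] by simp
    note unique = partial_fraction_unique[OF finite inj_pole[OF \<Delta>] U this]
    show ?thesis
      using unique(1) unique(2) by blast
  qed
  then have "k = 0" and "c i = 0" for i
    by (simp_all add: vec_eq_iff)
  then show "(\<forall>i. fuchsian_residue C B i (p + step n) ** lax \<Delta> z n p (pole \<Delta> i)
        = lax \<Delta> z n p (pole \<Delta> i) ** fuchsian_residue C B i p) \<and>
     (\<Sum>i\<in>UNIV. fuchsian_residue C B i (p + step n)) ** lax_slope \<Delta> z n p
        = lax_slope \<Delta> z n p + lax_slope \<Delta> z n p ** (\<Sum>i\<in>UNIV. fuchsian_residue C B i p)"
    by (simp add: c_def k_def R_def Q_def algebra_simps)
qed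

lemma residue_equations_imp_gauge_equation:
  assumes R: "gauge_residue_equations \<Delta> z (fuchsian_residue C B)" and \<mu>: "\<mu> \<notin> range (pole \<Delta>)"
  shows "fuchsian \<Delta> C B (p + step n) \<mu> ** lax \<Delta> z n p \<mu>
       = lax_slope \<Delta> z n p + lax \<Delta> z n p \<mu> ** fuchsian \<Delta> C B p \<mu>"
proof -
  define R where "R = fuchsian_residue C B"
  have "(\<Sum>i\<in>UNIV. (1 / (\<mu> - pole \<Delta> i)) \<cdot>
     (R i (p + step n) ** lax \<Delta> z n p (pole \<Delta> i) - lax \<Delta> z n p (pole \<Delta> i) ** R i p)) = 0"
    using R by (simp add: gauge_residue_equations_def R_def matrix_eq_2_iff)
  then show ?thesis
    using gauge_difference_expansion[OF \<mu>, of "\<lambda>i. R i (p + step n)" z n p "\<lambda>i. R i p"] R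
    by (simp add: fuchsian_eq_sum_residues R_def gauge_residue_equations_def algebra_simps)
qed

section \<open>The residues of an isomonodromic solution\<close>

text \<open>
  Differentiate \<open>\<Phi>\<^bsub>p+e\<^esub> = L \<Phi>\<^sub>p\<close> in \<open>\<mu>\<close>, replace the derivatives by means of the differential
  equation and cancel the invertible matrix \<open>\<Phi>\<^sub>p\<close>.
\<close>

lemma wave_branch_gauge_equation:
  assumes W: "wave_branch \<Delta> z A D \<Phi>" and D: "open D" "\<mu> \<in> D"
  shows "A (p + step n) \<mu> ** lax \<Delta> z n p \<mu> = lax_slope \<Delta> z n p + lax \<Delta> z n p \<mu> ** A p \<mu>"
proof -
  have \<Phi>: "((\<lambda>\<nu>. \<Phi> q \<nu> $ i $ j) has_field_derivative (A q \<mu> ** \<Phi> q \<mu>) $ i $ j) (at \<mu>)" for q i j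
    using W D(2) unfolding wave_branch_def by blast
  have step: "\<Phi> (p + step n) \<nu> = lax \<Delta> z n p \<nu> ** \<Phi> p \<nu>" if "\<nu> \<in> D" for \<nu>
    using W that unfolding wave_branch_def by blast
  have "(A (p + step n) \<mu> ** \<Phi> (p + step n) \<mu>) $ i $ j
      = (lax_slope \<Delta> z n p ** \<Phi> p \<mu> + lax \<Delta> z n p \<mu> ** (A p \<mu> ** \<Phi> p \<mu>)) $ i $ j" for i j
  proof (rule DERIV_unique)
    show "((\<lambda>\<nu>. (lax \<Delta> z n p \<nu> ** \<Phi> p \<nu>) $ i $ j) has_field_derivative
       (A (p + step n) \<mu> ** \<Phi> (p + step n) \<mu>) $ i $ j) (at \<mu>)"
      by (rule has_field_derivative_transform_within_open[OF \<Phi> D]) (simp only: step)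
    show "((\<lambda>\<nu>. (lax \<Delta> z n p \<nu> ** \<Phi> p \<nu>) $ i $ j) has_field_derivative
       (lax_slope \<Delta> z n p ** \<Phi> p \<mu> + lax \<Delta> z n p \<mu> ** (A p \<mu> ** \<Phi> p \<mu>)) $ i $ j) (at \<mu>)"
      by (rule matrix_mult_derivative[OF lax_derivative \<Phi>])
  qed
  then have "A (p + step n) \<mu> ** (lax \<Delta> z n p \<mu> ** \<Phi> p \<mu>)
      = lax_slope \<Delta> z n p ** \<Phi> p \<mu> + lax \<Delta> z n p \<mu> ** (A p \<mu> ** \<Phi> p \<mu>)"
    unfolding vec_eq_iff step[OF D(2)] by blast
  then have eq: "(A (p + step n) \<mu> ** lax \<Delta> z n p \<mu>) ** \<Phi> p \<mu>
      = (lax_slope \<Delta> z n p + lax \<Delta> z n p \<mu> ** A p \<mu>) ** \<Phi> p \<mu>"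
    by (simp only: matrix_mul_assoc matrix_add_mult_distrib)
  obtain V where V: "\<Phi> p \<mu> ** V = mat 1"
    using W D(2) unfolding wave_branch_def invertible_def by blast
  show ?thesis
    using arg_cong[OF eq, of "\<lambda>X. X ** V"] by (simp only: V matrix_mul_rid flip: matrix_mul_assoc)
qed

lemma exists_disc_avoiding:
  fixes S :: "complex set"
  assumes "\<And>x. \<not> x islimpt S"
  shows "\<exists>x r. 0 < r \<and> ball x r \<subseteq> - S"
proof -
  have "closed S"
    using assms by (auto simp: closed_limpt)
  moreover have "- S \<noteq> {}"
  proof
    assume "- S = {}"
    then have "S = UNIV" by auto
    then show False using assms[of 0] by (simp add: islimpt_UNIV)
  qed
  ultimately show ?thesis
    using openE[of "- S"] by (metis all_not_in_conv open_Compl)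
qed

text \<open>
  The compatibility is needed on one disc only: a rational function of \<open>\<mu>\<close> that vanishes there
  vanishes identically. Such a disc exists because the exceptional set is discrete.
\<close>

lemma isomonodromic_residue_equations:
  assumes \<Delta>: "\<And>n. \<Delta> n \<noteq> 0" "inj \<Delta>" and iso: "isomonodromic_with \<Delta> z (fuchsian \<Delta> C B)"
  shows "gauge_residue_equations \<Delta> z (fuchsian_residue C B)"
proof -
  obtain S W where S: "\<And>x. \<not> x islimpt S"
    and W: "multivalued_wave_function \<Delta> z (fuchsian \<Delta> C B) S W"
    using iso unfolding isomonodromic_with_def by blast
  have "\<not> x islimpt (S \<union> range (pole \<Delta>))" for x
    using S by (simp add: islimpt_Un islimpt_finite)
  then obtain x r where r: "0 < r" and ball: "ball x r \<subseteq> - (S \<union> range (pole \<Delta>))"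
    using exists_disc_avoiding[of "S \<union> range (pole \<Delta>)"] by blast
  have "open (ball x r) \<and> simply_connected (ball x r) \<and> ball x r \<subseteq> - S"
    using ball convex_imp_simply_connected[OF convex_ball] by auto
  then have "W (ball x r) \<noteq> {}" "\<forall>\<Phi>\<in>W (ball x r). wave_branch \<Delta> z (fuchsian \<Delta> C B) (ball x r) \<Phi>"
    using W unfolding multivalued_wave_function_def by blast+
  then obtain \<Phi> where \<Phi>: "wave_branch \<Delta> z (fuchsian \<Delta> C B) (ball x r) \<Phi>"
    by blast
  show ?thesis
  proof (rule gauge_equation_imp_residue_equations[OF \<Delta>])
    show "infinite (ball x r)"
      using r finite_imp_not_open[of "ball x r"] by auto
    show "\<mu> \<notin> range (pole \<Delta>) \<and> fuchsian \<Delta> C B (p + step n) \<mu> ** lax \<Delta> z n p \<mu>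
        = lax_slope \<Delta> z n p + lax \<Delta> z n p \<mu> ** fuchsian \<Delta> C B p \<mu>" if "\<mu> \<in> ball x r" for p n \<mu>
      using wave_branch_gauge_equation[OF \<Phi> open_ball that] ball that by blast
  qed
qed

lemma fuchsian_trace_free_imp_residues_trace_free:
  assumes \<Delta>: "\<And>n. \<Delta> n \<noteq> 0" "inj \<Delta>"
    and tr: "\<And>\<mu>. \<mu> \<notin> range (pole \<Delta>) \<Longrightarrow> trace (fuchsian \<Delta> C B p \<mu>) = 0"
  shows "trace (fuchsian_residue C B i p) = 0"
proof -
  have "infinite (- range (pole \<Delta>))"
    by (simp add: Compl_eq_Diff_UNIV infinite_UNIV_char_0)
  moreover have "\<mu> \<notin> range (pole \<Delta>) \<and>
      0 + (\<Sum>i\<in>UNIV. trace (fuchsian_residue C B i p) / (\<mu> - pole \<Delta> i)) = 0"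
    if "\<mu> \<in> - range (pole \<Delta>)" for \<mu>
    using tr[of \<mu>] that
    by (simp add: fuchsian_eq_sum_residues trace_2 sum.distrib add_divide_distrib)
  ultimately have "\<forall>i\<in>UNIV. trace (fuchsian_residue C B i p) = 0"
    by (rule partial_fraction_unique(2)[OF finite inj_pole[OF \<Delta>]])
  then show ?thesis by blast
qed

text \<open>
  At \<open>\<mu> = 0\<close> the transition matrix is the unipotent matrix with off-diagonal entry
  \<open>z\<^bsub>p+e\<^esub> - z\<^sub>p\<close>. So the conjugate \<open>K\<close> of \<open>C\<^sub>p\<close> by the unipotent matrix of \<open>z\<^sub>p\<close> does not depend on
  the lattice point, and its entries are the constants \<open>b, c, d\<close> up to numerical factors.
\<close>

lemma residue_at_0_eq_C_form:
  assumes R: "gauge_residue_equations \<Delta> z (fuchsian_residue C B)" and tr: "trace (C 0) = 0"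
  shows "\<exists>b c d. \<forall>p. C p = C_form z b c d p"
proof -
  define K where "K p = mat2 1 (- z p) 0 1 ** C p ** mat2 1 (z p) 0 1" for p
  have C_shift: "C (p + step n) ** mat2 1 (fwd z n p) 0 1 = mat2 1 (fwd z n p) 0 1 ** C p" for p n
  proof -
    have "lax \<Delta> z n p 0 = mat2 1 (fwd z n p) 0 1"
      by (simp add: lax_def)
    moreover have "C (p + step n) ** lax \<Delta> z n p (pole \<Delta> None) = lax \<Delta> z n p (pole \<Delta> None) ** C p"
      using gauge_residue_equationsD(1)[OF R, of None p n] by (simp only: fuchsian_residue.simps)
    ultimately show ?thesis by simp
  qed
  have "K (p + step n) = K p" for p n
  proof -
    have z': "z (p + step n) = z p + fwd z n p"
      by (simp add: fwd_def)
    have up: "mat2 1 (z (p + step n)) 0 1 = mat2 1 (fwd z n p) 0 1 ** mat2 1 (z p) 0 1"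
      and down: "mat2 1 (- z (p + step n)) 0 1 ** mat2 1 (fwd z n p) 0 1 = mat2 1 (- z p) 0 1"
      by (simp_all add: matrix_eq_2_iff z')
    have "K (p + step n) = mat2 1 (- z (p + step n)) 0 1 **
        (C (p + step n) ** mat2 1 (fwd z n p) 0 1) ** mat2 1 (z p) 0 1"
      unfolding K_def up by (simp only: matrix_mul_assoc)
    also have "\<dots> = K p"
      unfolding C_shift K_def by (simp only: matrix_mul_assoc down)
    finally show ?thesis .
  qed
  then have K: "K p = K 0" for p
    by (rule lattice_constant)
  have C_K: "C p = mat2 1 (z p) 0 1 ** K 0 ** mat2 1 (- z p) 0 1" for p
  proof -
    have "C p = mat2 1 (z p) 0 1 ** K p ** mat2 1 (- z p) 0 1"
      by (simp add: K_def matrix_eq_2_iff algebra_simps)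
    then show ?thesis using K[of p] by simp
  qed
  have K_tr: "K 0 $ 1 $ 1 = - K 0 $ 2 $ 2"
    using tr unfolding C_K[of 0] by (simp add: trace_2 algebra_simps add_eq_0_iff)
  show ?thesis
  proof (intro exI allI)
    fix p
    show "C p = C_form z (- 2 * K 0 $ 2 $ 1) (4 * K 0 $ 2 $ 2) (2 * K 0 $ 1 $ 2) p"
      unfolding C_K[of p] C_form_def
      by (simp add: matrix_eq_2_iff K_tr algebra_simps power2_eq_square)
  qed
qed

text \<open>
  In the upper right entry of the equation at a finite pole the value of \<open>\<mu>\<close> does not occur, since
  the last column and the first row of \<open>L\<close> are independent of \<open>\<mu>\<close>. These entries can therefore be summed
  over all poles, although \<open>L\<close> is evaluated at a different point in each of the equations.
\<close>

lemma residue_sum_diagonal_shift: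
  fixes R :: "3 option \<Rightarrow> int ^ 3 \<Rightarrow> complex ^ 2 ^ 2"
  assumes z: "nondegenerate z"
    and inter: "\<And>i. R i (p + step n) ** lax \<Delta> z n p (pole \<Delta> i) = lax \<Delta> z n p (pole \<Delta> i) ** R i p"
    and M12: "\<And>q. (\<Sum>i\<in>UNIV. R i q) $ 1 $ 2 = 0"
  shows "(\<Sum>i\<in>UNIV. R i (p + step n)) $ 1 $ 1 = (\<Sum>i\<in>UNIV. R i p) $ 2 $ 2"
proof -
  define M where "M q = (\<Sum>i\<in>UNIV. R i q)" for q
  have "(\<Sum>i\<in>UNIV. (R i (p + step n) ** lax \<Delta> z n p (pole \<Delta> i)) $ 1 $ 2)
      = (\<Sum>i\<in>UNIV. (lax \<Delta> z n p (pole \<Delta> i) ** R i p) $ 1 $ 2)"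
    by (simp only: inter)
  then have "M (p + step n) $ 1 $ 1 * fwd z n p + M (p + step n) $ 1 $ 2
      = M p $ 1 $ 2 + fwd z n p * M p $ 2 $ 2"
    by (simp add: lax_def M_def sum.distrib sum_distrib_left sum_distrib_right)
  moreover have "M q $ 1 $ 2 = 0" for q
    unfolding M_def by (rule M12)
  ultimately show ?thesis
    using nondegenerate_fwd[OF z, of n p] by (simp flip: M_def)
qed

text \<open>
  The sum \<open>M\<close> of the residues is what the behaviour at \<open>\<mu> = \<infinity>\<close> controls. The vanishing of its upper
  right entry is the origin of the constraint on \<open>z\<close>. Its trace grows by \<open>1\<close> with every step,
  reflecting \<open>det L = 1 - \<mu> \<Delta>\<^sub>n\<close>.
\<close>

lemma gauge_residue_sum:
  assumes \<Delta>: "\<And>n. \<Delta> n \<noteq> 0" and z: "nondegenerate z" and R: "gauge_residue_equations \<Delta> z R"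
  defines "M \<equiv> \<lambda>p. \<Sum>i\<in>UNIV. R i p"
  shows "M p $ 1 $ 2 = 0" and "trace (M (p + step n)) = trace (M p) + 1"
proof -
  have f: "\<Delta> n / fwd z n p \<noteq> 0" for n p
    using \<Delta> z by (simp add: nondegenerate_fwd)
  have M: "M (p + step n) ** lax_slope \<Delta> z n p = lax_slope \<Delta> z n p + lax_slope \<Delta> z n p ** M p" for p n
    using R by (simp add: gauge_residue_equations_def M_def)
  show M12: "M p $ 1 $ 2 = 0" for p
    using M[of p 1] f[of 1 p] by (simp add: matrix_eq_2_iff lax_slope_def)
  have "M (p + step n) $ 2 $ 2 * (\<Delta> n / fwd z n p) = (1 + M p $ 1 $ 1) * (\<Delta> n / fwd z n p)"
    using M[of p n] by (simp add: matrix_eq_2_iff lax_slope_def ring_distribs mult.commute)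
  then have M22: "M (p + step n) $ 2 $ 2 = 1 + M p $ 1 $ 1"
    using f by simp
  have "M (p + step n) $ 1 $ 1 = M p $ 2 $ 2"
    unfolding M_def
    by (rule residue_sum_diagonal_shift[OF z gauge_residue_equationsD(1)[OF R] M12[unfolded M_def]])
  with M22 show "trace (M (p + step n)) = trace (M p) + 1"
    by (simp add: trace_2)
qed

text \<open>
  A step in direction \<open>n\<close> conjugates all residues except the one at \<open>1/\<Delta>\<^sub>n\<close>, where \<open>L\<close> is singular.
  That residue alone absorbs the growth of the total trace, so its trace counts the steps in
  direction \<open>n\<close>.
\<close>

lemma residue_traces_and_dets:
  assumes \<Delta>: "\<And>n. \<Delta> n \<noteq> 0" "inj \<Delta>" and z: "nondegenerate z"
    and R: "gauge_residue_equations \<Delta> z (fuchsian_residue C B)"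
    and tr: "\<And>i. trace (fuchsian_residue C B i 0) = 0"
  shows "trace (C p) = 0" and "trace (B n p) = of_int (p $ n)"
    and "m \<noteq> n \<Longrightarrow> det (B n (p + step m)) = det (B n p)"
proof -
  define R where "R = fuchsian_residue C B"
  have conj: "trace (R i (p + step n)) = trace (R i p) \<and> det (R i (p + step n)) = det (R i p)"
    if "i \<noteq> Some n" for i n p
  proof -
    have "pole \<Delta> i * \<Delta> n \<noteq> 1"
      using that \<Delta> by (cases i) (auto simp: field_simps inj_eq)
    then show ?thesis
      using similar_imp_trace_det_eq[OF _ invertible_lax[OF z]] R
      unfolding gauge_residue_equations_def R_def by blast
  qed
  have shift: "trace (R (Some n) (p + step n)) = trace (R (Some n) p) + 1" for n p
  proof -
    have tr_sum: "trace (\<Sum>i\<in>UNIV. R i q) = trace (R (Some n) q) + (\<Sum>i\<in>UNIV - {Some n}. trace (R i q))" for q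
      by (simp add: trace_2 sum.distrib sum.remove[of UNIV "Some n"])
    have "(\<Sum>i\<in>UNIV - {Some n}. trace (R i (p + step n))) = (\<Sum>i\<in>UNIV - {Some n}. trace (R i p))"
      using conj by (intro sum.cong) auto
    then show ?thesis
      using gauge_residue_sum(2)[OF \<Delta>(1) z R, of p n] by (simp add: tr_sum flip: R_def)
  qed
  have "trace (R None p) = 0"
    using tr[of None] by (induction p rule: lattice_induct) (simp_all add: conj R_def[symmetric])
  then show "trace (C p) = 0" by (simp add: R_def)
  have "trace (R (Some n) p) = of_int (p $ n)"
  proof (induction p rule: lattice_induct)
    case (2 p m)
    then show ?case
      using conj[of "Some n" m p] shift[of m p] by (cases "m = n") (auto simp: axis_def)
  qed (use tr[of "Some n"] in \<open>simp add: R_def\<close>)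
  then show "trace (B n p) = of_int (p $ n)" by (simp add: R_def)
  show "det (B n (p + step m)) = det (B n p)" if "m \<noteq> n"
    using conj[of "Some n" m p] that by (simp add: R_def)
qed

text \<open>
  The transition matrix at its singular point is the product of the column \<open>(1, 1/f)\<close> and the row
  \<open>(1, f)\<close>. Therefore the row is a left eigenvector of \<open>X\<close>, the column is a right eigenvector of
  \<open>X'\<close>, and both belong to the same eigenvalue \<open>l\<close>.
\<close>

lemma rank_one_intertwiner_eigenvector:
  fixes X X' :: "complex ^ 2 ^ 2"
  assumes f: "f \<noteq> 0" and eq: "X' ** mat2 1 f (1 / f) 1 = mat2 1 f (1 / f) 1 ** X"
  defines "l \<equiv> X $ 1 $ 1 + f * X $ 2 $ 1"
  shows "X $ 1 $ 2 + f * X $ 2 $ 2 = f * l"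
    and "f * X' $ 1 $ 1 + X' $ 1 $ 2 = f * l" and "f * X' $ 2 $ 1 + X' $ 2 $ 2 = l"
  using eq f unfolding l_def matrix_eq_2_iff
  by (auto simp: field_simps)

text \<open>
  The edges in direction \<open>n\<close> that leave and enter \<open>p\<close> supply a left eigenvector \<open>(1, f\<^sub>n)\<close> and a
  right eigenvector \<open>(f\<^sub>n\<^sup>-, 1)\<close> of \<open>B\<^bsup>(n)\<^esup>\<^sub>p\<close>. Their product \<open>f\<^sub>n + f\<^sub>n\<^sup>-\<close> is nonzero, so they belong
  to the same eigenvalue \<open>l p\<close>; together with the trace \<open>k\<^sub>n\<close> this determines the matrix, with
  \<open>a\<^sub>n = 2 l\<close>.

  It remains to see that \<open>l\<close> is constant. In direction \<open>n\<close> it is, by the equality of the two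
  eigenvalues. In another direction the determinant \<open>l (k\<^sub>n - l)\<close> is preserved, which leaves the
  alternative \<open>l' = l\<close> or \<open>l' = k\<^sub>n - l\<close>. Since \<open>l\<close> and \<open>l'\<close> do not change under a shift in
  direction \<open>n\<close> while \<open>k\<^sub>n\<close> does, comparing the two determinant equations gives \<open>l' = l\<close>.
\<close>

lemma residue_at_lattice_pole_form:
  assumes \<Delta>: "\<And>n. \<Delta> n \<noteq> 0" and z: "nondegenerate z"
    and R: "gauge_residue_equations \<Delta> z (fuchsian_residue C B)"
    and tr: "\<And>p. trace (B n p) = of_int (p $ n)"
    and det: "\<And>p m. m \<noteq> n \<Longrightarrow> det (B n (p + step m)) = det (B n p)"
  shows "\<exists>a. \<forall>p. B n p =
     ((of_int (p $ n) - a) / (fwd z n p + bwd z n p)) \<cdot>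
        mat2 (fwd z n p) (- (fwd z n p * bwd z n p)) (- 1) (bwd z n p) + (a / 2) \<cdot> mat 1"
proof -
  define l where "l p = B n p $ 1 $ 1 + fwd z n p * B n p $ 2 $ 1" for p
  have inter: "B n (p + step n) ** mat2 1 (fwd z n p) (1 / fwd z n p) 1
      = mat2 1 (fwd z n p) (1 / fwd z n p) 1 ** B n p" for p
  proof -
    have "B n (p + step n) ** lax \<Delta> z n p (pole \<Delta> (Some n)) = lax \<Delta> z n p (pole \<Delta> (Some n)) ** B n p"
      using gauge_residue_equationsD(1)[OF R, of "Some n" p n] by (simp only: fuchsian_residue.simps)
    then show ?thesis
      using \<Delta>[of n] by (simp add: lax_def)
  qed
  have left: "B n p $ 1 $ 2 + fwd z n p * B n p $ 2 $ 2 = fwd z n p * l p" for p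
    using rank_one_intertwiner_eigenvector(1)[OF nondegenerate_fwd[OF z] inter] by (simp add: l_def)
  have right: "bwd z n p * B n p $ 1 $ 1 + B n p $ 1 $ 2 = bwd z n p * l (p - step n)"
      "bwd z n p * B n p $ 2 $ 1 + B n p $ 2 $ 2 = l (p - step n)" for p
    using rank_one_intertwiner_eigenvector(2,3)[OF nondegenerate_fwd[OF z] inter[of "p - step n"]]
      bwd_shift[of z n "p - step n"]
    by (simp_all add: l_def)
  have nz: "fwd z n p + bwd z n p \<noteq> 0" for p
    using z by (simp add: nondegenerate_def)
  have l_prev: "l (p - step n) = l p" for p
  proof -
    have "(fwd z n p + bwd z n p) * l (p - step n) = (fwd z n p + bwd z n p) * l p"
      using left[of p] right[of p] l_def[of p] by algebra
    then show ?thesis using nz by simp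
  qed
  have c_solve: "c * (f + g) = 2 * e - t" if "a + d = t" "g * c + d = e" "e = a + f * c"
    for a c d e f g t :: complex
  proof -
    have "c * (f + g) = (g * c + d) + (a + f * c) - (a + d)"
      by (simp add: algebra_simps)
    then show ?thesis using that by simp
  qed
  have form: "B n p =
     ((of_int (p $ n) - 2 * l p) / (fwd z n p + bwd z n p)) \<cdot>
        mat2 (fwd z n p) (- (fwd z n p * bwd z n p)) (- 1) (bwd z n p) + (2 * l p / 2) \<cdot> mat 1" for p
  proof -
    \<comment> \<open>The weight of the rank-one part of the asserted form.\<close>
    define c where "c = (of_int (p $ n) - 2 * l p) / (fwd z n p + bwd z n p)"
    have "c * (fwd z n p + bwd z n p) = of_int (p $ n) - 2 * l p"
      using nz by (simp add: c_def)
    moreover have "B n p $ 2 $ 1 * (fwd z n p + bwd z n p) = 2 * l p - of_int (p $ n)"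
      using tr[of p] right(2)[of p] l_def[of p] unfolding trace_2 l_prev by (rule c_solve)
    ultimately have "(B n p $ 2 $ 1 + c) * (fwd z n p + bwd z n p) = 0"
      by (simp add: distrib_right)
    then have c: "B n p $ 2 $ 1 = - c"
      using nz by (simp add: add_eq_0_iff2)
    have 22: "B n p $ 2 $ 2 = c * bwd z n p + l p"
      using right(2)[of p, symmetric] unfolding l_prev c by simp
    have 11: "B n p $ 1 $ 1 = c * fwd z n p + l p"
      using l_def[of p] unfolding c by simp
    have "B n p $ 1 $ 2 = fwd z n p * l p - fwd z n p * (c * bwd z n p + l p)"
      using left[of p] unfolding 22 by (simp only: eq_diff_eq)
    then have 12: "B n p $ 1 $ 2 = - (c * (fwd z n p * bwd z n p))"
      by (simp add: algebra_simps)
    then show ?thesis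
      unfolding c_def[symmetric] by (simp add: matrix_eq_2_iff c 11 12 22)
  qed
  have "det (B n p) = l p * (of_int (p $ n) - l p)" for p
  proof -
    have t: "of_int (p $ n) - l p = B n p $ 2 $ 2 - fwd z n p * B n p $ 2 $ 1"
      using tr[of p, symmetric] l_def[of p] by (simp add: trace_2)
    have b: "B n p $ 1 $ 2 = fwd z n p * l p - fwd z n p * B n p $ 2 $ 2"
      using left[of p] by (simp only: eq_diff_eq)
    show ?thesis
      unfolding det_2 t b unfolding l_def[of p] by (simp add: algebra_simps)
  qed
  then have l_det: "l (p + step m) * (of_int (p $ n) - l (p + step m)) = l p * (of_int (p $ n) - l p)"
    if "m \<noteq> n" for p m
    using det[OF that, of p] that by (simp add: axis_def)
  have l_next: "l (p + step n) = l p" for p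
    using l_prev[of "p + step n"] by simp
  have "l (p + step m) = l p" for p m
  proof (cases "m = n")
    case False
    have "p + step n + step m = p + step m + step n"
      by (simp add: add_ac)
    then have "l (p + step n + step m) = l (p + step m)"
      by (simp only: l_next)
    moreover have "of_int ((p + step n) $ n) = (of_int (p $ n) + 1 :: complex)"
      by (simp add: axis_nth)
    ultimately have "l (p + step m) * (of_int (p $ n) + 1 - l (p + step m)) = l p * (of_int (p $ n) + 1 - l p)"
      using l_det[OF False, of "p + step n"] by (simp only: l_next)
    moreover have "x = x * (k + 1 - x) - x * (k - x)" for x k :: complex
      by (simp add: algebra_simps)
    ultimately show ?thesis
      using l_det[OF False, of p] by metis
  qed (simp add: l_next)
  then have "l p = l 0" for p
    by (rule lattice_constant)
  with form show ?thesis
    by (intro exI[of _ "2 * l 0"]) metis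
qed

section \<open>The explicit residues satisfy the gauge equation\<close>

text \<open>
  The three equations of the system, cleared of denominators, are one and the same symmetric
  relation for the elementary squares. It is trivial for \<open>n = m\<close>, so it is available for all pairs
  of directions.
\<close>

lemma cross_ratio_quad:
  assumes "cross_ratio_system \<Delta> z" and z: "nondegenerate z" and \<Delta>: "\<And>n. \<Delta> n \<noteq> 0"
  shows "\<Delta> m * (fwd z n p * fwd z n (p + step m)) = \<Delta> n * (fwd z m p * fwd z m (p + step n))"
proof -
  have quad: "\<Delta> m * (fwd z n p * fwd z n (p + step m)) = \<Delta> n * (fwd z m p * fwd z m (p + step n))"
    if "\<And>p. cross_ratio (z p) (z (p + step n)) (z (p + step n - step m)) (z (p - step m)) = \<Delta> n / \<Delta> m"
    for n m p
  proof -
    have "((z (p + step m + step n) - z (p + step m)) * (z p - z (p + step n)))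
        / ((z (p + step n) - z (p + step m + step n)) * (z (p + step m) - z p)) = \<Delta> n / \<Delta> m"
      using that[of "p + step m"] by (simp add: cross_ratio_def add_ac add_diff_eq)
    moreover have "z (p + step n) - z (p + step m + step n) = - fwd z m (p + step n)"
      "z (p + step m) - z p = fwd z m p" "z p - z (p + step n) = - fwd z n p"
      "z (p + step m + step n) - z (p + step m) = fwd z n (p + step m)"
      by (simp_all add: fwd_def add_ac)
    ultimately have "(fwd z n (p + step m) * fwd z n p) / (fwd z m (p + step n) * fwd z m p) = \<Delta> n / \<Delta> m"
      by simp
    then show ?thesis
      using nondegenerate_fwd[OF z] \<Delta> by (simp add: frac_eq_eq mult_ac)
  qed
  have sys: "\<And>p. cross_ratio (z p) (z (p + step 1)) (z (p + step 1 - step 3)) (z (p - step 3)) = \<Delta> 1 / \<Delta> 3"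
    "\<And>p. cross_ratio (z p) (z (p + step 3)) (z (p + step 3 - step 2)) (z (p - step 2)) = \<Delta> 3 / \<Delta> 2"
    "\<And>p. cross_ratio (z p) (z (p + step 2)) (z (p + step 2 - step 1)) (z (p - step 1)) = \<Delta> 2 / \<Delta> 1"
    using assms(1) by (simp_all add: cross_ratio_system_def)
  show ?thesis
    using exhaust_3[of n] exhaust_3[of m]
      quad[OF sys(1), of p] quad[OF sys(2), of p] quad[OF sys(3), of p]
    by (elim disjE) simp_all
qed

lemma fwd_square: "fwd z n (p + step m) = fwd z m (p + step n) + fwd z n p - fwd z m p"
  by (simp add: fwd_def add_ac)

text \<open>
  With \<open>F\<close> and \<open>G\<close> the edges opposite to \<open>f\<close> and \<open>g\<close>, all entries reduce to the closing condition
  \<open>f + G = g + F\<close> of the square and to the cross-ratio relation \<open>\<Delta>\<^sub>m f F = \<Delta>\<^sub>n g G\<close>.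
\<close>

lemma lax_zero_curvature:
  assumes cr: "cross_ratio_system \<Delta> z" and z: "nondegenerate z" and \<Delta>: "\<And>n. \<Delta> n \<noteq> 0"
  shows "lax \<Delta> z m (p + step n) \<mu> ** lax \<Delta> z n p \<mu> = lax \<Delta> z n (p + step m) \<mu> ** lax \<Delta> z m p \<mu>"
proof -
  define f g F G where "f = fwd z n p" and "g = fwd z m p"
    and "F = fwd z n (p + step m)" and "G = fwd z m (p + step n)"
  have nz: "f \<noteq> 0" "g \<noteq> 0" "F \<noteq> 0" "G \<noteq> 0"
    using nondegenerate_fwd[OF z] by (simp_all add: f_def g_def F_def G_def)
  have q: "\<Delta> m * (f * F) = \<Delta> n * (g * G)"
    unfolding f_def g_def F_def G_def by (rule cross_ratio_quad[OF cr z \<Delta>])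
  have sq: "F = G + f - g"
    unfolding f_def g_def F_def G_def by (rule fwd_square)
  have dm: "\<Delta> m = \<Delta> n * (g * G) / (f * F)"
    using q nz by (simp add: field_simps)
  have 21: "\<mu> * (\<Delta> m / G) + \<mu> * (\<Delta> n / f) = \<mu> * (\<Delta> n / F) + \<mu> * (\<Delta> m / g)"
  proof -
    have "\<Delta> m / G - \<Delta> m / g = \<Delta> n / F - \<Delta> n / f"
    proof -
      have "\<Delta> m / G - \<Delta> m / g = \<Delta> n * (g - G) / (f * F)"
        unfolding dm using nz by (simp add: field_simps)
      also have "g - G = f - F"
        using sq by simp
      also have "\<Delta> n * (f - F) / (f * F) = \<Delta> n / F - \<Delta> n / f"
        using nz by (simp add: field_simps)
      finally show ?thesis .
    qed
    then have "\<Delta> m / G + \<Delta> n / f = \<Delta> n / F + \<Delta> m / g"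
      by (simp add: algebra_simps)
    then show ?thesis
      by (metis distrib_left)
  qed
  have 11: "G * (\<mu> * (\<Delta> n / f)) = F * (\<mu> * (\<Delta> m / g))"
    unfolding dm using nz by (simp add: field_simps)
  have 22: "\<mu> * (\<Delta> m / G) * f = \<mu> * (\<Delta> n / F) * g"
    unfolding dm using nz by (simp add: field_simps)
  show ?thesis
    using 11 21 22 sq
    by (simp add: matrix_eq_2_iff lax_def flip: f_def g_def F_def G_def)
qed

text \<open>
  Moving along an edge acts on pairs of a lattice point and a matrix. This action is
  bijective since \<open>L\<close> is invertible, and actions in different directions commute by zero curvature;
  the orbit of \<open>(0, 1)\<close> consists of the pairs \<open>(p, T p)\<close>.
\<close>

lemma transition_matrices:
  assumes cr: "cross_ratio_system \<Delta> z" and z: "nondegenerate z" and \<Delta>: "\<And>n. \<Delta> n \<noteq> 0"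
    and \<mu>: "\<And>n. \<mu> * \<Delta> n \<noteq> 1"
  shows "\<exists>T. T 0 = mat 1 \<and> (\<forall>p n. T (p + step n) = lax \<Delta> z n p \<mu> ** T p)"
proof -
  define \<sigma> where "\<sigma> n = (\<lambda>(p, X :: complex ^ 2 ^ 2). (p + step n, lax \<Delta> z n p \<mu> ** X))" for n :: 3
  have "bij (\<sigma> n)" for n
  proof -
    have "\<exists>V. lax \<Delta> z n p \<mu> ** V = mat 1 \<and> V ** lax \<Delta> z n p \<mu> = mat 1" for p
      using invertible_lax[OF z, of \<mu> \<Delta> n p] \<mu> unfolding invertible_def by blast
    then obtain V where V: "\<And>p. lax \<Delta> z n p \<mu> ** V p = mat 1" "\<And>p. V p ** lax \<Delta> z n p \<mu> = mat 1"
      by metis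
    show ?thesis
      by (rule o_bij[of "\<lambda>(p, X). (p - step n, V (p - step n) ** X)"])
        (auto simp: \<sigma>_def fun_eq_iff matrix_mul_assoc V)
  qed
  moreover have "\<sigma> n \<circ> \<sigma> m = \<sigma> m \<circ> \<sigma> n" for n m
    using lax_zero_curvature[OF cr z \<Delta>, of n _ m \<mu>]
    by (auto simp: \<sigma>_def fun_eq_iff matrix_mul_assoc add_ac)
  ultimately obtain \<psi> where \<psi>: "\<psi> 0 = (0, mat 1)" "\<And>p n. \<psi> (p + step n) = \<sigma> n (\<psi> p)"
    using commuting_bijections_orbit[of \<sigma> "(0, mat 1)"] by blast
  have fst_step: "fst (\<psi> (p + step n)) = fst (\<psi> p) + step n"
    and snd_step: "snd (\<psi> (p + step n)) = lax \<Delta> z n (fst (\<psi> p)) \<mu> ** snd (\<psi> p)" for p n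
    by (simp_all only: \<psi>(2) \<sigma>_def case_prod_unfold fst_conv snd_conv)
  have "fst (\<psi> p) = p" for p
  proof (rule lattice_induct[where P = "\<lambda>p. fst (\<psi> p) = p"])
    show "fst (\<psi> 0) = 0"
      by (simp only: \<psi>(1) fst_conv)
    show "fst (\<psi> p) = p \<longleftrightarrow> fst (\<psi> (p + step n)) = p + step n" for p n
      by (simp only: fst_step add_right_cancel)
  qed
  then have "snd (\<psi> (p + step n)) = lax \<Delta> z n p \<mu> ** snd (\<psi> p)" for p n
    by (simp only: snd_step)
  then show ?thesis
    using \<psi>(1) by (intro exI[of _ "\<lambda>p. snd (\<psi> p)"]) simp
qed

text \<open>
  Write \<open>h\<close> for \<open>f\<^sub>n\<close>, let \<open>f, g\<close> be \<open>f\<^sub>m, f\<^sub>m\<^sup>-\<close> at \<open>p\<close>, and \<open>F, G\<close> the same quantities at \<open>p + e\<^sub>n\<close>.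
  Up to the scalar \<open>a\<^sub>m/2\<close> and the weights \<open>v\<close>, \<open>u\<close>, the residues are the rank-one matrices formed by
  the columns \<open>(f, -1)\<close>, \<open>(F, -1)\<close> and the rows \<open>(1, -g)\<close>, \<open>(1, -G)\<close>. The cross-ratio relations of
  the two squares spanned by \<open>e\<^sub>n\<close> and \<open>\<plusminus>e\<^sub>m\<close> say that \<open>L\<close> maps the column at \<open>p\<close> to \<open>1 - t f\<close> times
  the column at \<open>p + e\<^sub>n\<close>, and the row at \<open>p + e\<^sub>n\<close> to \<open>1 - G t\<close> times the row at \<open>p\<close>. So both sides
  are multiples of the same matrix, and it remains to compare the factors. For \<open>n = m\<close> the factors
  vanish, which is why the change of the weight does no harm there.
\<close>

lemma B_form_intertwined:
  assumes cr: "cross_ratio_system \<Delta> z" and z: "nondegenerate z" and \<Delta>: "\<And>n. \<Delta> n \<noteq> 0"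
  shows "B_form z a m (p + step n) ** lax \<Delta> z n p (1 / \<Delta> m)
       = lax \<Delta> z n p (1 / \<Delta> m) ** B_form z a m p"
proof -
  define h f g F G where "h = fwd z n p" and "f = fwd z m p" and "g = bwd z m p"
    and "F = fwd z m (p + step n)" and "G = bwd z m (p + step n)"
  define t where "t = 1 / \<Delta> m * (\<Delta> n / h)"
  have h: "h \<noteq> 0"
    using nondegenerate_fwd[OF z] by (simp add: h_def)
  have fg: "f + g \<noteq> 0" "F + G \<noteq> 0"
    using z by (simp_all add: nondegenerate_def f_def g_def F_def G_def)
  have tF: "t * f * F = F + h - f"
  proof -
    have "\<Delta> m * (h * (F + h - f)) = \<Delta> n * (f * F)"
      using cross_ratio_quad[OF cr z \<Delta>, of m n p] fwd_square[of z n p m]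
      by (simp add: h_def f_def F_def)
    then show ?thesis
      using h \<Delta>[of m] by (simp add: t_def field_simps)
  qed
  have tG: "t * g * G = h + g - G"
  proof -
    define q where "q = p - step m"
    have q: "p = q + step m" "p + step n = q + step n + step m"
      by (simp_all add: q_def)
    have g: "g = fwd z m q"
      unfolding g_def q(1) by (rule bwd_shift)
    have G: "G = fwd z m (q + step n)"
      unfolding G_def q(2) by (rule bwd_shift)
    have "\<Delta> m * (fwd z n q * fwd z n p) = \<Delta> n * (g * G)"
      using cross_ratio_quad[OF cr z \<Delta>, of m n q] unfolding g G q(1) .
    moreover have "fwd z n q = h + g - G"
      unfolding h_def g G using fwd_square[of z n q m] q(1) by simp
    ultimately have "\<Delta> m * ((h + g - G) * h) = \<Delta> n * (g * G)"
      by (simp add: h_def)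
    then show ?thesis
      using h \<Delta>[of m] by (simp add: t_def field_simps)
  qed
  define u v where "u = (of_int ((p + step n) $ m) - a m) / (F + G)"
    and "v = (of_int (p $ m) - a m) / (f + g)"
  have weights: "u * (1 - G * t) = v * (1 - t * f)"
  proof (cases "n = m")
    case True
    then have "t * f = 1" "G * t = 1"
      using h \<Delta>[of m] by (simp_all add: t_def h_def f_def G_def bwd_shift)
    then show ?thesis by simp
  next
    case False
    have "(1 - G * t) * (f + g) - (1 - t * f) * (F + G) = (f + g) - (F + G) + t * f * F - t * g * G"
      by (simp add: algebra_simps)
    also have "\<dots> = 0"
      unfolding tF tG by simp
    finally have scale: "(1 - G * t) * (f + g) = (1 - t * f) * (F + G)"
      by simp
    have uv: "u * (F + G) = v * (f + g)"
      using fg False by (simp add: u_def v_def axis_def)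
    have "(u * (1 - G * t)) * ((f + g) * (F + G)) = (u * (F + G)) * ((1 - G * t) * (f + g))"
      by (simp only: mult_ac)
    also have "\<dots> = (v * (1 - t * f)) * ((f + g) * (F + G))"
      unfolding uv scale by (simp only: mult_ac)
    finally have "(u * (1 - G * t)) * ((f + g) * (F + G)) = (v * (1 - t * f)) * ((f + g) * (F + G))" .
    then show ?thesis using fg by simp
  qed
  have Bp: "B_form z a m p = v \<cdot> mat2 f (- (f * g)) (- 1) g + (a m / 2) \<cdot> mat 1"
    and Bq: "B_form z a m (p + step n) = u \<cdot> mat2 F (- (F * G)) (- 1) G + (a m / 2) \<cdot> mat 1"
    by (simp_all add: B_form_def u_def v_def f_def g_def F_def G_def)
  have L: "lax \<Delta> z n p (1 / \<Delta> m) = mat2 1 h t 1"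
    by (simp add: lax_def h_def t_def)
  have right: "F * (1 - t * f) = f - h" and left: "g * (1 - G * t) = G - h"
    using tF tG by (simp_all add: algebra_simps)
  have 11: "u * F - u * (F * G) * t = v * f - h * v"
  proof -
    have "u * F - u * (F * G) * t = F * (u * (1 - G * t))"
      by (simp add: algebra_simps)
    also have "\<dots> = v * (F * (1 - t * f))"
      unfolding weights by (simp only: mult_ac)
    finally show ?thesis
      unfolding right by (simp add: algebra_simps)
  qed
  have 12: "u * F * h - u * (F * G) = - v * (f * g) + h * v * g"
  proof -
    have "u * F * h - u * (F * G) = - (F * u * (G - h))"
      by (simp add: algebra_simps)
    also have "\<dots> = - (F * g * (u * (1 - G * t)))"
      unfolding left[symmetric] by (simp only: mult_ac)
    also have "\<dots> = - (v * g * (F * (1 - t * f)))"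
      unfolding weights by (simp only: mult_ac)
    finally show ?thesis
      unfolding right by (simp add: algebra_simps)
  qed
  have 21: "- u + u * G * t = t * v * f - v"
    using weights by (simp add: algebra_simps)
  have 22: "- u * h + u * G = - t * v * (f * g) + v * g"
  proof -
    have "- u * h + u * G = u * (G - h)"
      by (simp add: algebra_simps)
    also have "\<dots> = g * (u * (1 - G * t))"
      unfolding left[symmetric] by (simp only: mult_ac)
    finally show ?thesis
      unfolding weights by (simp add: algebra_simps)
  qed
  show ?thesis
    unfolding Bp Bq L matrix_eq_2_iff using 11 12 21 22
    by (simp add: algebra_simps)
qed

text \<open>
  Links the equation at \<open>\<mu> = \<infinity>\<close> with the constraint on \<open>z\<close>, in either direction of the theorem.
\<close>

lemma residue_sum_entry_12:
  "(\<Sum>i\<in>UNIV. fuchsian_residue (C_form z b c d) (B_form z a) i p) $ 1 $ 2 = 0 \<longleftrightarrow>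
   b * (z p)\<^sup>2 + c * z p + d =
     (\<Sum>n\<in>UNIV. 2 * (of_int (p $ n) - a n) * (fwd z n p * bwd z n p / (fwd z n p + bwd z n p)))"
proof -
  define X where "X n = 2 * (of_int (p $ n) - a n) *
    (fwd z n p * bwd z n p / (fwd z n p + bwd z n p))" for n
  have "B_form z a n p $ 1 $ 2 = - 1 / 2 * X n" for n
  proof -
    have "x / s * - y = - 1 / 2 * (2 * x * (y / s))" for x y s :: complex
      by simp
    then show ?thesis
      unfolding X_def by (simp only: B_form_def vector_add_component cscale_nth mat2_nth mat_1_nth_2 mult_zero_right add_0_right)
  qed
  then have "(\<Sum>n\<in>UNIV. B_form z a n p $ 1 $ 2) = - 1 / 2 * (\<Sum>n\<in>UNIV. X n)"
    by (simp only: sum_distrib_left)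
  then have half: "(\<Sum>i\<in>UNIV. fuchsian_residue (C_form z b c d) (B_form z a) i p) $ 1 $ 2
      = 1 / 2 * ((b * (z p)\<^sup>2 + c * z p + d) - (\<Sum>n\<in>UNIV. X n))"
    by (simp add: sum_option C_form_def right_diff_distrib)
  show ?thesis
    unfolding half X_def[symmetric] by simp
qed

text \<open>
  The equations at the finite poles hold by the shape of the residues. The equation
  at \<open>\<mu> = \<infinity>\<close> asks for \<open>M\<^sub>1\<^sub>2 = 0\<close>, which is the constraint, and for \<open>M'\<^sub>2\<^sub>2 = 1 + M\<^sub>1\<^sub>1\<close>. The latter
  follows from \<open>M'\<^sub>1\<^sub>1 = M\<^sub>2\<^sub>2\<close> and from the known traces \<open>tr M = k\<^sub>1 + k\<^sub>2 + k\<^sub>3\<close>.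
\<close>

lemma explicit_residue_equations:
  assumes \<Delta>: "\<And>n. \<Delta> n \<noteq> 0" and z: "nondegenerate z"
    and cr: "cross_ratio_system \<Delta> z" and con: "isomonodromy_constraint z b c d a"
  shows "gauge_residue_equations \<Delta> z (fuchsian_residue (C_form z b c d) (B_form z a))"
proof -
  define R where "R = fuchsian_residue (C_form z b c d) (B_form z a)"
  define M where "M p = (\<Sum>i\<in>UNIV. R i p)" for p
  have inter: "R i (p + step n) ** lax \<Delta> z n p (pole \<Delta> i) = lax \<Delta> z n p (pole \<Delta> i) ** R i p" for i p n
  proof (cases i)
    case None
    have "z (p + step n) = z p + fwd z n p"
      by (simp add: fwd_def)
    then show ?thesis
      by (simp add: None R_def C_form_def lax_def matrix_eq_2_iff power2_eq_square)
        (simp add: field_simps)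
  next
    case (Some m)
    then show ?thesis
      using B_form_intertwined[OF cr z \<Delta>] by (simp add: R_def)
  qed
  have M12: "M p $ 1 $ 2 = 0" for p
    using con residue_sum_entry_12 unfolding isomonodromy_constraint_def M_def R_def by blast
  have M_tr: "M p $ 1 $ 1 + M p $ 2 $ 2 = (\<Sum>m\<in>UNIV. of_int (p $ m))" for p
  proof -
    have "B_form z a m p $ 1 $ 1 + B_form z a m p $ 2 $ 2 = of_int (p $ m)" for m
    proof -
      have "fwd z m p + bwd z m p \<noteq> 0"
        using z by (simp add: nondegenerate_def)
      moreover have "B_form z a m p $ 1 $ 1 + B_form z a m p $ 2 $ 2
          = (of_int (p $ m) - a m) / (fwd z m p + bwd z m p) * (fwd z m p + bwd z m p) + a m"
        by (simp add: B_form_def distrib_left)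
      ultimately show ?thesis by simp
    qed
    then have "(\<Sum>m\<in>UNIV. B_form z a m p $ 1 $ 1 + B_form z a m p $ 2 $ 2) = (\<Sum>m\<in>UNIV. of_int (p $ m))"
      by simp
    then show ?thesis
      by (simp add: M_def R_def sum_option C_form_def sum.distrib algebra_simps)
  qed
  have M_shift: "M (p + step n) $ 1 $ 1 = M p $ 2 $ 2" for p n
    unfolding M_def by (rule residue_sum_diagonal_shift[OF z inter M12[unfolded M_def]])
  have "M (p + step n) $ 2 $ 2 = 1 + M p $ 1 $ 1" for p n
  proof -
    have "of_int ((p + step n) $ m) = of_int (p $ m) + (if m = n then 1 else 0 :: complex)" for m
      by (simp add: axis_def)
    then have "(\<Sum>m\<in>UNIV. of_int ((p + step n) $ m)) = (\<Sum>m\<in>UNIV. of_int (p $ m)) + (1 :: complex)"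
      by (simp only: sum.distrib) simp
    then have "M (p + step n) $ 1 $ 1 + M (p + step n) $ 2 $ 2 = (M p $ 1 $ 1 + M p $ 2 $ 2) + 1"
      by (simp only: M_tr)
    then show ?thesis
      unfolding M_shift by (simp add: add_ac)
  qed
  then have "M (p + step n) ** lax_slope \<Delta> z n p = lax_slope \<Delta> z n p + lax_slope \<Delta> z n p ** M p" for p n
    by (simp add: matrix_eq_2_iff lax_slope_def M12 algebra_simps)
  with inter show ?thesis
    unfolding gauge_residue_equations_def R_def M_def by blast
qed

section \<open>Construction of the wave function\<close>

text \<open>
  The gauge equation transports the differential equation along edges in both directions. Forward
  this is the product rule. Backward, \<open>\<Phi>\<^sub>p = L\<^sup>-\<^sup>1 \<Phi>\<^bsub>p+e\<^esub>\<close> is differentiable by the explicit inverse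
  of \<open>L\<close>, and the value \<open>X\<close> of its derivative is then found from the product rule for
  \<open>\<Phi>\<^bsub>p+e\<^esub> = L \<Phi>\<^sub>p\<close> by cancelling \<open>L\<close>.
\<close>

lemma wave_branch_from_base_point:
  assumes z: "nondegenerate z" and D: "open D" "D \<subseteq> - range (pole \<Delta>)"
    and gauge: "\<And>p n \<mu>. \<mu> \<in> D \<Longrightarrow>
      A (p + step n) \<mu> ** lax \<Delta> z n p \<mu> = lax_slope \<Delta> z n p + lax \<Delta> z n p \<mu> ** A p \<mu>"
    and \<Phi>_step: "\<And>p n \<mu>. \<mu> \<in> D \<Longrightarrow> \<Phi> (p + step n) \<mu> = lax \<Delta> z n p \<mu> ** \<Phi> p \<mu>"
    and inv: "\<And>\<mu>. \<mu> \<in> D \<Longrightarrow> invertible (\<Phi> 0 \<mu>)"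
    and ode: "\<And>\<mu> i j. \<mu> \<in> D \<Longrightarrow>
      ((\<lambda>\<nu>. \<Phi> 0 \<nu> $ i $ j) has_field_derivative (A 0 \<mu> ** \<Phi> 0 \<mu>) $ i $ j) (at \<mu>)"
  shows "wave_branch \<Delta> z A D \<Phi>"
proof -
  have D_ne: "\<mu> * \<Delta> n \<noteq> 1" if "\<mu> \<in> D" for \<mu> n
    using mult_eq_1_imp_pole[of \<mu> \<Delta> n] D(2) that by blast
  define solves where "solves p \<longleftrightarrow> (\<forall>\<mu>\<in>D. \<forall>i j.
      ((\<lambda>\<nu>. \<Phi> p \<nu> $ i $ j) has_field_derivative (A p \<mu> ** \<Phi> p \<mu>) $ i $ j) (at \<mu>))" for p
  have gauge_\<Phi>: "A (p + step n) \<mu> ** \<Phi> (p + step n) \<mu>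
      = lax_slope \<Delta> z n p ** \<Phi> p \<mu> + lax \<Delta> z n p \<mu> ** (A p \<mu> ** \<Phi> p \<mu>)" if "\<mu> \<in> D" for p n \<mu>
    using arg_cong[OF gauge[OF that, of p n], of "\<lambda>X. X ** \<Phi> p \<mu>"]
    by (simp only: \<Phi>_step[OF that] matrix_mul_assoc matrix_add_mult_distrib)
  have product: "((\<lambda>\<nu>. \<Phi> (p + step n) \<nu> $ i $ j) has_field_derivative
        (lax_slope \<Delta> z n p ** \<Phi> p \<mu> + lax \<Delta> z n p \<mu> ** X) $ i $ j) (at \<mu>)"
    if "\<mu> \<in> D" and "\<And>i j. ((\<lambda>\<nu>. \<Phi> p \<nu> $ i $ j) has_field_derivative X $ i $ j) (at \<mu>)" for p n \<mu> X i j
    by (rule has_field_derivative_transform_within_open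
        [OF matrix_mult_derivative[OF lax_derivative that(2)] D(1) that(1)]) (simp only: \<Phi>_step)
  have up: "solves (p + step n)" if "solves p" for p n
    unfolding solves_def
  proof (intro ballI allI)
    fix \<mu> i j assume \<mu>: "\<mu> \<in> D"
    show "((\<lambda>\<nu>. \<Phi> (p + step n) \<nu> $ i $ j) has_field_derivative
        (A (p + step n) \<mu> ** \<Phi> (p + step n) \<mu>) $ i $ j) (at \<mu>)"
      unfolding gauge_\<Phi>[OF \<mu>] using that \<mu> unfolding solves_def by (intro product) blast+
  qed
  have down: "solves p" if "solves (p + step n)" for p n
    unfolding solves_def
  proof (intro ballI)
    fix \<mu> assume \<mu>: "\<mu> \<in> D"
    define q where "q = p + step n"
    define f where "f = fwd z n p"
    define c where "c = \<Delta> n / f"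
    have f: "f \<noteq> 0"
      unfolding f_def by (rule nondegenerate_fwd[OF z])
    have q_diff: "(\<lambda>\<nu>. \<Phi> q \<nu> $ i $ j) field_differentiable at \<mu>" for i j
      using that \<mu> unfolding solves_def q_def field_differentiable_def by blast
    have \<Phi>_down: "\<Phi> p \<nu> $ 1 $ j = (\<Phi> q \<nu> $ 1 $ j - f * \<Phi> q \<nu> $ 2 $ j) / (1 - \<nu> * \<Delta> n)"
      "\<Phi> p \<nu> $ 2 $ j = (\<Phi> q \<nu> $ 2 $ j - \<nu> * c * \<Phi> q \<nu> $ 1 $ j) / (1 - \<nu> * \<Delta> n)"
      if "\<nu> \<in> D" for \<nu> j
    proof -
      have nz: "1 - \<nu> * \<Delta> n \<noteq> 0"
        using D_ne[OF that, of n] by simp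
      have cf: "c * f = \<Delta> n"
        using f by (simp add: c_def)
      have "\<Phi> q \<nu> $ 1 $ j - f * \<Phi> q \<nu> $ 2 $ j = (1 - \<nu> * (c * f)) * \<Phi> p \<nu> $ 1 $ j"
        "\<Phi> q \<nu> $ 2 $ j - \<nu> * c * \<Phi> q \<nu> $ 1 $ j = (1 - \<nu> * (c * f)) * \<Phi> p \<nu> $ 2 $ j"
        unfolding q_def \<Phi>_step[OF that]
        by (simp_all add: lax_def flip: f_def c_def) (simp_all add: algebra_simps)
      then show "\<Phi> p \<nu> $ 1 $ j = (\<Phi> q \<nu> $ 1 $ j - f * \<Phi> q \<nu> $ 2 $ j) / (1 - \<nu> * \<Delta> n)"
        "\<Phi> p \<nu> $ 2 $ j = (\<Phi> q \<nu> $ 2 $ j - \<nu> * c * \<Phi> q \<nu> $ 1 $ j) / (1 - \<nu> * \<Delta> n)"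
        unfolding cf using nz by simp_all
    qed
    have "\<exists>d. ((\<lambda>\<nu>. \<Phi> p \<nu> $ i $ j) has_field_derivative d) (at \<mu>)" for i j
    proof -
      have nz: "1 - \<mu> * \<Delta> n \<noteq> 0"
        using D_ne[OF \<mu>, of n] by simp
      have "(\<lambda>\<nu>. (\<Phi> q \<nu> $ 1 $ j - f * \<Phi> q \<nu> $ 2 $ j) / (1 - \<nu> * \<Delta> n)) field_differentiable at \<mu>"
        "(\<lambda>\<nu>. (\<Phi> q \<nu> $ 2 $ j - \<nu> * c * \<Phi> q \<nu> $ 1 $ j) / (1 - \<nu> * \<Delta> n)) field_differentiable at \<mu>"
        by (intro derivative_intros q_diff nz)+
      then obtain d1 d2
        where "((\<lambda>\<nu>. (\<Phi> q \<nu> $ 1 $ j - f * \<Phi> q \<nu> $ 2 $ j) / (1 - \<nu> * \<Delta> n)) has_field_derivative d1) (at \<mu>)"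
          "((\<lambda>\<nu>. (\<Phi> q \<nu> $ 2 $ j - \<nu> * c * \<Phi> q \<nu> $ 1 $ j) / (1 - \<nu> * \<Delta> n)) has_field_derivative d2) (at \<mu>)"
        unfolding field_differentiable_def by blast
      then have "((\<lambda>\<nu>. \<Phi> p \<nu> $ 1 $ j) has_field_derivative d1) (at \<mu>)"
        "((\<lambda>\<nu>. \<Phi> p \<nu> $ 2 $ j) has_field_derivative d2) (at \<mu>)"
        by (auto intro: has_field_derivative_transform_within_open[OF _ D(1) \<mu>] simp: \<Phi>_down)
      then show ?thesis
        using exhaust_2[of i] by blast
    qed
    then obtain d where d: "\<And>i j. ((\<lambda>\<nu>. \<Phi> p \<nu> $ i $ j) has_field_derivative d i j) (at \<mu>)"
      by metis
    define X where "X = (\<chi> i j. d i j)"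
    have X: "((\<lambda>\<nu>. \<Phi> p \<nu> $ i $ j) has_field_derivative X $ i $ j) (at \<mu>)" for i j
      using d by (simp add: X_def)
    have "(lax_slope \<Delta> z n p ** \<Phi> p \<mu> + lax \<Delta> z n p \<mu> ** X) $ i $ j
        = (A (p + step n) \<mu> ** \<Phi> (p + step n) \<mu>) $ i $ j" for i j
    proof (rule DERIV_unique[OF product[OF \<mu> X]])
      show "((\<lambda>\<nu>. \<Phi> (p + step n) \<nu> $ i $ j) has_field_derivative
          (A (p + step n) \<mu> ** \<Phi> (p + step n) \<mu>) $ i $ j) (at \<mu>)"
        using that \<mu> unfolding solves_def by blast
    qed
    then have "lax_slope \<Delta> z n p ** \<Phi> p \<mu> + lax \<Delta> z n p \<mu> ** X
        = A (p + step n) \<mu> ** \<Phi> (p + step n) \<mu>"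
      unfolding vec_eq_iff by blast
    then have LX: "lax \<Delta> z n p \<mu> ** X = lax \<Delta> z n p \<mu> ** (A p \<mu> ** \<Phi> p \<mu>)"
      unfolding gauge_\<Phi>[OF \<mu>] by (rule add_left_imp_eq)
    obtain V where "V ** lax \<Delta> z n p \<mu> = mat 1"
      using invertible_lax[OF z, of \<mu> \<Delta> n p] D_ne[OF \<mu>] unfolding invertible_def by blast
    then have "X = A p \<mu> ** \<Phi> p \<mu>"
      using arg_cong[OF LX, of "\<lambda>X. V ** X"] by (simp only: matrix_mul_assoc matrix_mul_lid)
    then show "\<forall>i j. ((\<lambda>\<nu>. \<Phi> p \<nu> $ i $ j) has_field_derivative (A p \<mu> ** \<Phi> p \<mu>) $ i $ j) (at \<mu>)"
      using X by blast
  qed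
  have "solves p" for p
  proof (rule lattice_induct)
    show "solves 0"
      using ode unfolding solves_def by blast
  qed (use up down in blast)
  moreover have "invertible (\<Phi> p \<mu>)" if "\<mu> \<in> D" for p \<mu>
  proof (rule lattice_induct[where P = "\<lambda>p. invertible (\<Phi> p \<mu>)"])
    show "invertible (\<Phi> 0 \<mu>)"
      by (rule inv[OF that])
    show "invertible (\<Phi> p \<mu>) \<longleftrightarrow> invertible (\<Phi> (p + step n) \<mu>)" for p n
      using invertible_lax[OF z, of \<mu> \<Delta> n p] D_ne[OF that]
      by (simp add: \<Phi>_step[OF that] invertible_det_nz det_mul)
  qed
  ultimately show ?thesis
    using \<Phi>_step unfolding wave_branch_def solves_def by blast
qed

lemma lax_orbit_unique:
  assumes z: "nondegenerate z" and \<mu>: "\<And>n. \<mu> * \<Delta> n \<noteq> 1"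
    and \<Phi>: "\<And>p n. \<Phi> (p + step n) = lax \<Delta> z n p \<mu> ** \<Phi> p"
    and \<Psi>: "\<And>p n. \<Psi> (p + step n) = lax \<Delta> z n p \<mu> ** \<Psi> p"
    and 0: "\<Phi> 0 = \<Psi> 0"
  shows "\<Phi> p = \<Psi> p"
proof (rule lattice_induct[where P = "\<lambda>p. \<Phi> p = \<Psi> p"])
  fix p n
  obtain V where V: "V ** lax \<Delta> z n p \<mu> = mat 1"
    using invertible_lax[OF z, of \<mu> \<Delta> n p] \<mu> unfolding invertible_def by blast
  have "\<Phi> p = \<Psi> p" if "lax \<Delta> z n p \<mu> ** \<Phi> p = lax \<Delta> z n p \<mu> ** \<Psi> p"
    using arg_cong[OF that, of "\<lambda>X. V ** X"] by (simp only: matrix_mul_assoc V matrix_mul_lid)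
  then show "\<Phi> p = \<Psi> p \<longleftrightarrow> \<Phi> (p + step n) = \<Psi> (p + step n)"
    unfolding \<Phi> \<Psi> by auto
qed (rule 0)

text \<open>
  All wave functions have the form \<open>T\<^sub>p(\<mu>) Y(\<mu>)\<close>, with \<open>T\<close> the single-valued transition matrices from
  the base point and \<open>Y\<close> a fundamental matrix of the differential equation at the base point. Only
  \<open>Y\<close> can be multivalued. As branches over \<open>D\<close> one may take all wave functions over \<open>D\<close>: a branch is
  continued to \<open>D'\<close> by the fundamental matrix over \<open>D'\<close> times the constant matrix \<open>K\<close> that relates
  the two on the connected set \<open>D \<inter> D'\<close>.
\<close>

lemma isomonodromic_from_residue_equations:
  assumes \<Delta>: "\<And>n. \<Delta> n \<noteq> 0" "inj \<Delta>" and z: "nondegenerate z" and cr: "cross_ratio_system \<Delta> z"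
    and R: "gauge_residue_equations \<Delta> z (fuchsian_residue C B)"
  shows "isomonodromic_with \<Delta> z (fuchsian \<Delta> C B)"
proof -
  define S where "S = range (pole \<Delta>)"
  define A where "A = fuchsian \<Delta> C B"
  define W where "W D = {\<Phi>. wave_branch \<Delta> z A D \<Phi>}" for D
  have S: "\<mu> * \<Delta> n \<noteq> 1" if "\<mu> \<notin> S" for \<mu> n
    using mult_eq_1_imp_pole[of \<mu> \<Delta> n] that unfolding S_def by blast
  have "\<exists>T. T 0 = mat 1 \<and> (\<forall>p n. T (p + step n) = lax \<Delta> z n p \<mu> ** T p)" if "\<mu> \<notin> S" for \<mu>
    by (rule transition_matrices[OF cr z \<Delta>(1) S[OF that]])
  then obtain T where T0: "\<And>\<mu>. \<mu> \<notin> S \<Longrightarrow> T \<mu> 0 = mat 1"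
    and T_step: "\<And>\<mu> p n. \<mu> \<notin> S \<Longrightarrow> T \<mu> (p + step n) = lax \<Delta> z n p \<mu> ** T \<mu> p"
    by metis
  have branch: "wave_branch \<Delta> z A D (\<lambda>p \<mu>. T \<mu> p ** Y \<mu>)"
    if D: "open D" "D \<subseteq> - S" and inv: "\<And>\<mu>. \<mu> \<in> D \<Longrightarrow> invertible (Y \<mu>)"
      and Y: "\<And>\<mu> i j. \<mu> \<in> D \<Longrightarrow> ((\<lambda>\<nu>. Y \<nu> $ i $ j) has_field_derivative (A 0 \<mu> ** Y \<mu>) $ i $ j) (at \<mu>)"
    for D Y
  proof (rule wave_branch_from_base_point[OF z D(1)])
    show "D \<subseteq> - range (pole \<Delta>)"
      using D(2) by (simp add: S_def)
    fix \<mu> assume \<mu>: "\<mu> \<in> D"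
    then have \<mu>S: "\<mu> \<notin> S" using D(2) by blast
    show "A (p + step n) \<mu> ** lax \<Delta> z n p \<mu> = lax_slope \<Delta> z n p + lax \<Delta> z n p \<mu> ** A p \<mu>" for p n
      unfolding A_def using \<mu>S by (intro residue_equations_imp_gauge_equation[OF R]) (simp add: S_def)
    show "T \<mu> (p + step n) ** Y \<mu> = lax \<Delta> z n p \<mu> ** (T \<mu> p ** Y \<mu>)" for p n
      by (simp only: T_step[OF \<mu>S] matrix_mul_assoc)
    show "invertible (T \<mu> 0 ** Y \<mu>)"
      using inv[OF \<mu>] by (simp add: T0[OF \<mu>S])
    show "((\<lambda>\<nu>. (T \<nu> 0 ** Y \<nu>) $ i $ j) has_field_derivative (A 0 \<mu> ** (T \<mu> 0 ** Y \<mu>)) $ i $ j) (at \<mu>)" for i j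
      unfolding T0[OF \<mu>S] matrix_mul_lid
    proof (rule has_field_derivative_transform_within_open[OF Y[OF \<mu>] D(1) \<mu>])
      show "Y \<nu> $ i $ j = (T \<nu> 0 ** Y \<nu>) $ i $ j" if "\<nu> \<in> D" for \<nu>
      proof -
        have "\<nu> \<notin> S" using D(2) that by blast
        from T0[OF this] show ?thesis by (simp only: matrix_mul_lid)
      qed
    qed
  qed
  have fundamental: "\<exists>Y Z. fundamental_pair (A 0) D Y Z"
    if "open D" "simply_connected D" "D \<subseteq> - S" for D
  proof (rule linear_ode_simply_connected[OF that(1,2)])
    show "(\<lambda>\<mu>. A 0 \<mu> $ i $ j) holomorphic_on D" for i j
      unfolding A_def using fuchsian_holomorphic that(3) unfolding S_def by (rule holomorphic_on_subset)
  qed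
  have fundamental_invertible: "invertible (Y \<mu>)" if "fundamental_pair (A 0) D Y Z" "\<mu> \<in> D" for D Y Z \<mu>
    using that unfolding fundamental_pair_def invertible_left_inverse by blast
  have fundamental_derivative:
    "((\<lambda>\<nu>. Y \<nu> $ i $ j) has_field_derivative (A 0 \<mu> ** Y \<mu>) $ i $ j) (at \<mu>)"
    if "fundamental_pair (A 0) D Y Z" "\<mu> \<in> D" for D Y Z \<mu> i j
    using that unfolding fundamental_pair_def by blast
  have exists: "W D \<noteq> {}" if D: "open D" "simply_connected D" "D \<subseteq> - S" for D
  proof -
    obtain Y Z where YZ: "fundamental_pair (A 0) D Y Z"
      using fundamental[OF D] by blast
    have "wave_branch \<Delta> z A D (\<lambda>p \<mu>. T \<mu> p ** Y \<mu>)"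
      by (rule branch[OF D(1,3) fundamental_invertible[OF YZ] fundamental_derivative[OF YZ]])
    then show ?thesis unfolding W_def by blast
  qed
  have continuation: "\<exists>\<Phi>'\<in>W D'. \<forall>p. \<forall>\<mu>\<in>D \<inter> D'. \<Phi>' p \<mu> = \<Phi> p \<mu>"
    if D: "open D" "D \<subseteq> - S" and D': "open D'" "simply_connected D'" "D' \<subseteq> - S"
      and conn: "connected (D \<inter> D')" and \<Phi>: "\<Phi> \<in> W D" for D D' \<Phi>
  proof (cases "D \<inter> D' = {}")
    case True
    then show ?thesis
      using exists[OF D'] by auto
  next
    case False
    then obtain x where x: "x \<in> D \<inter> D'" by blast
    have \<Phi>_branch: "wave_branch \<Delta> z A D \<Phi>"
      using \<Phi> by (simp add: W_def)
    obtain Y Z where YZ: "fundamental_pair (A 0) D' Y Z"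
      using fundamental[OF D'] by blast
    have "\<exists>K. \<forall>\<mu>\<in>D \<inter> D'. \<Phi> 0 \<mu> = Y \<mu> ** K"
    proof (rule fundamental_pair_comparison[OF YZ open_Int[OF D(1) D'(1)] conn])
      show "((\<lambda>\<nu>. \<Phi> 0 \<nu> $ i $ j) has_field_derivative (A 0 \<mu> ** \<Phi> 0 \<mu>) $ i $ j) (at \<mu>)"
        if "\<mu> \<in> D \<inter> D'" for \<mu> i j
        using \<Phi>_branch that unfolding wave_branch_def by blast
    qed blast
    then obtain K where K: "\<And>\<mu>. \<mu> \<in> D \<inter> D' \<Longrightarrow> \<Phi> 0 \<mu> = Y \<mu> ** K"
      by blast
    have "invertible (\<Phi> 0 x)"
      using \<Phi>_branch x unfolding wave_branch_def by blast
    then have K_inv: "invertible K"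
      unfolding K[OF x] by (simp add: invertible_det_nz det_mul)
    have "wave_branch \<Delta> z A D' (\<lambda>p \<mu>. T \<mu> p ** (Y \<mu> ** K))"
    proof (rule branch[OF D'(1,3)])
      show "invertible (Y \<mu> ** K)" if "\<mu> \<in> D'" for \<mu>
        by (rule invertible_mult[OF fundamental_invertible[OF YZ that] K_inv])
      show "((\<lambda>\<nu>. (Y \<nu> ** K) $ i $ j) has_field_derivative (A 0 \<mu> ** (Y \<mu> ** K)) $ i $ j) (at \<mu>)"
        if "\<mu> \<in> D'" for \<mu> i j
      proof -
        have "((\<lambda>\<nu>. K $ i $ j) has_field_derivative (0 :: complex ^ 2 ^ 2) $ i $ j) (at \<mu>)" for i j
          by simp
        from matrix_mult_derivative[OF fundamental_derivative[OF YZ that] this, of i j]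
        show ?thesis by (simp add: matrix_mul_assoc)
      qed
    qed
    moreover have "T \<mu> p ** (Y \<mu> ** K) = \<Phi> p \<mu>" if "\<mu> \<in> D \<inter> D'" for p \<mu>
    proof -
      have \<mu>: "\<mu> \<notin> S" using that D(2) by blast
      show ?thesis
      proof (rule lax_orbit_unique[OF z S[OF \<mu>]])
        show "T \<mu> (p + step n) ** (Y \<mu> ** K) = lax \<Delta> z n p \<mu> ** (T \<mu> p ** (Y \<mu> ** K))" for p n
          by (simp only: T_step[OF \<mu>] matrix_mul_assoc)
        show "\<Phi> (p + step n) \<mu> = lax \<Delta> z n p \<mu> ** \<Phi> p \<mu>" for p n
          using \<Phi>_branch that unfolding wave_branch_def by blast
        show "T \<mu> 0 ** (Y \<mu> ** K) = \<Phi> 0 \<mu>"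
          by (simp only: T0[OF \<mu>] K[OF that] matrix_mul_lid)
      qed
    qed
    ultimately show ?thesis
      unfolding W_def by (intro bexI[of _ "\<lambda>p \<mu>. T \<mu> p ** (Y \<mu> ** K)"]) auto
  qed
  have "multivalued_wave_function \<Delta> z A S W"
    unfolding multivalued_wave_function_def
  proof (intro conjI allI impI ballI)
    fix D assume D: "open D \<and> simply_connected D \<and> D \<subseteq> - S"
    then show "W D \<noteq> {}" using exists by blast
    show "wave_branch \<Delta> z A D \<Phi>" if "\<Phi> \<in> W D" for \<Phi>
      using that by (simp add: W_def)
  next
    fix D D' \<Phi>
    assume "open D \<and> simply_connected D \<and> D \<subseteq> - S \<and>
        open D' \<and> simply_connected D' \<and> D' \<subseteq> - S \<and> connected (D \<inter> D')" "\<Phi> \<in> W D"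
    then show "\<exists>\<Phi>'\<in>W D'. \<forall>p. \<forall>\<mu>\<in>D \<inter> D'. \<Phi>' p \<mu> = \<Phi> p \<mu>"
      by (intro continuation) blast+
  qed
  moreover define N :: "complex \<Rightarrow> nat" where "N x = (if x \<in> S then 1 else 0)" for x
  have "- zorder (\<lambda>\<mu>. A p \<mu> $ i $ j) x \<le> int (N x)" if "is_pole (\<lambda>\<mu>. A p \<mu> $ i $ j) x" for p i j x
    using simple_fraction_sum_pole[OF finite inj_pole[OF \<Delta>], of "\<lambda>k. fuchsian_residue C B k p $ i $ j" x] that
    unfolding A_def fuchsian_nth by (simp add: N_def S_def)
  moreover have "(\<lambda>\<mu>. A p \<mu> $ i $ j) meromorphic_on UNIV" for p i j
    unfolding A_def fuchsian_nth by (intro meromorphic_intros)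
  moreover have "(\<lambda>\<mu>. A p \<mu> $ i $ j) holomorphic_on - S" for p i j
    unfolding A_def S_def by (rule fuchsian_holomorphic)
  moreover have "\<not> x islimpt S" for x
    unfolding S_def by (intro islimpt_finite) simp
  moreover have "{x. N x \<noteq> 0} \<subseteq> S"
    by (auto simp: N_def)
  ultimately show ?thesis
    unfolding isomonodromic_with_def A_def[symmetric] using cr by blast
qed

section \<open>The characterisation of isomonodromic solutions\<close>

theorem theorem8p1:
  fixes \<Delta> :: "3 \<Rightarrow> complex" and z :: "int ^ 3 \<Rightarrow> complex"
  assumes "\<And>n. \<Delta> n \<noteq> 0" and "inj \<Delta>" and "nondegenerate z"
  shows "(\<forall>C B.
            isomonodromic_with \<Delta> z (fuchsian \<Delta> C B) \<and>
            (\<forall>\<mu>. \<mu> \<noteq> 0 \<and> (\<forall>n. \<mu> \<noteq> 1 / \<Delta> n) \<longrightarrow> trace (fuchsian \<Delta> C B 0 \<mu>) = 0) \<longrightarrow>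
            (\<exists>b c d a.
               (\<forall>p. C p = C_form z b c d p) \<and>
               (\<forall>n p. B n p = B_form z a n p) \<and>
               isomonodromy_constraint z b c d a))
       \<and> (\<forall>b c d a.
            cross_ratio_system \<Delta> z \<and> isomonodromy_constraint z b c d a \<longrightarrow>
            isomonodromic_with \<Delta> z (fuchsian \<Delta> (C_form z b c d) (B_form z a)))"
proof (intro conjI allI impI)
  fix C B
  assume A: "isomonodromic_with \<Delta> z (fuchsian \<Delta> C B) \<and>
    (\<forall>\<mu>. \<mu> \<noteq> 0 \<and> (\<forall>n. \<mu> \<noteq> 1 / \<Delta> n) \<longrightarrow> trace (fuchsian \<Delta> C B 0 \<mu>) = 0)"
  have R: "gauge_residue_equations \<Delta> z (fuchsian_residue C B)"
    using isomonodromic_residue_equations[OF assms(1,2)] A by blast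
  have tr: "trace (fuchsian_residue C B i 0) = 0" for i
    by (rule fuchsian_trace_free_imp_residues_trace_free[OF assms(1,2)]) (use A in \<open>auto simp: range_pole\<close>)
  note traces = residue_traces_and_dets[OF assms(1-3) R tr]
  obtain b c d where C: "\<And>p. C p = C_form z b c d p"
    using residue_at_0_eq_C_form[OF R traces(1)] by blast
  have "\<exists>a. \<forall>p. B n p = ((of_int (p $ n) - a) / (fwd z n p + bwd z n p)) \<cdot>
        mat2 (fwd z n p) (- (fwd z n p * bwd z n p)) (- 1) (bwd z n p) + (a / 2) \<cdot> mat 1" for n
    by (rule residue_at_lattice_pole_form[OF assms(1,3) R traces(2,3)])
  then obtain a where "\<And>n p. B n p = ((of_int (p $ n) - a n) / (fwd z n p + bwd z n p)) \<cdot>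
        mat2 (fwd z n p) (- (fwd z n p * bwd z n p)) (- 1) (bwd z n p) + (a n / 2) \<cdot> mat 1"
    by metis
  then have B: "B n p = B_form z a n p" for n p
    by (simp add: B_form_def)
  have "C = C_form z b c d" "B = B_form z a"
    by (intro ext C B)+
  then have "isomonodromy_constraint z b c d a"
    using gauge_residue_sum(1)[OF assms(1,3) R] residue_sum_entry_12[of z b c d a]
    unfolding isomonodromy_constraint_def by blast
  with C B show "\<exists>b c d a. (\<forall>p. C p = C_form z b c d p) \<and> (\<forall>n p. B n p = B_form z a n p) \<and>
      isomonodromy_constraint z b c d a"
    by blast
next
  fix b c d a
  assume "cross_ratio_system \<Delta> z \<and> isomonodromy_constraint z b c d a"
  then show "isomonodromic_with \<Delta> z (fuchsian \<Delta> (C_form z b c d) (B_form z a))"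
    using isomonodromic_from_residue_equations[OF assms] explicit_residue_equations[of \<Delta> z b c d a]
      assms(1,3) by blast
qed

end
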